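(* Let $G$ be a finite simple connected graph with at least two vertices, and let $\lambda_2(G)$ be its second largest distance eigenvalue. If $\lambda_2(G)<\frac{-3+\sqrt{5}}{2}$, then $G$ is chordal.
   Context: For a finite simple connected graph $G$ with vertex set $\{v_1,\dots,v_n\}$, $n\ge 2$, $d_G(u,v)$ is the length of a shortest path between $u$ and $v$, and the distance matrix is the real symmetric matrix $D(G)=(d_G(v_i,v_j))_{1\le i,j\le n}$. Its eigenvalues, listed with multiplicity as $\lambda_1(G)\ge\lambda_2(G)\ge\dots\ge\lambda_n(G)$, are the distance eigenvalues of $G$; $\lambda_2(G)$ is the second largest distance eigenvalue. A graph is chordal if every cycle of length at least four in it has a chord, i.e. an edge of the graph joining two vertices that are not adjacent on the cycle (equivalently, there is no induced cycle of length at least four). *)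

theory Defs
  imports
    "Graph_Theory.Digraph_Component"
    "Jordan_Normal_Form.Char_Poly"
    "HOL-Library.Multiset"
begin

text \<open>
  A finite simple graph is a \<^locale>\<open>pair_graph\<close>: a finite loop-free digraph with a symmetric
  set of arcs \<^term>\<open>parcs G\<close>, so an edge joining \<^term>\<open>x\<close> and \<^term>\<open>y\<close> is the pair of arcs
  \<^term>\<open>(x, y)\<close> and \<^term>\<open>(y, x)\<close>.  An apath is a walk, given by its list of arcs, that repeats
  no vertex.
\<close>

definition graph_dist :: "'a pair_pre_digraph \<Rightarrow> 'a \<Rightarrow> 'a \<Rightarrow> nat" where
  "graph_dist G u v = (LEAST k. \<exists>p. pre_digraph.apath (with_proj G) u p v \<and> length p = k)"

text \<open>The list \<^term>\<open>vs\<close> is the enumeration of the vertices that indexes the matrix.\<close>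

definition distance_matrix :: "'a pair_pre_digraph \<Rightarrow> 'a list \<Rightarrow> real mat" where
  "distance_matrix G vs =
     mat (length vs) (length vs) (\<lambda>(i, j). real (graph_dist G (vs ! i) (vs ! j)))"

text \<open>
  Real eigenvalues with algebraic multiplicity, in descending order.  For a real symmetric
  matrix these are all the eigenvalues; see \<open>length_eigenvalues_desc\<close> below.
\<close>

definition eigenvalues_desc :: "real mat \<Rightarrow> real list" where
  "eigenvalues_desc A = rev (sorted_list_of_multiset (proots (char_poly A)))"

text \<open>List positions start at 0, so \<open>\<lambda>\<^sub>2\<close> is the entry at position 1.\<close>

definition distance_lambda2 :: "'a pair_pre_digraph \<Rightarrow> 'a list \<Rightarrow> real" where
  "distance_lambda2 G vs = eigenvalues_desc (distance_matrix G vs) ! 1"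

text \<open>
  Here \<^term>\<open>p\<close> is the arc list of a cycle, so its vertices are the tails of its arcs, and two
  vertices are adjacent on the cycle iff \<^term>\<open>p\<close> contains an arc between them, in either
  direction.
\<close>

definition is_chord :: "'a pair_pre_digraph \<Rightarrow> ('a \<times> 'a) list \<Rightarrow> 'a \<times> 'a \<Rightarrow> bool" where
  "is_chord G p e \<longleftrightarrow> e \<in> parcs G \<and> fst e \<in> fst ` set p \<and> snd e \<in> fst ` set p
     \<and> e \<notin> set p \<and> prod.swap e \<notin> set p"

definition chordal :: "'a pair_pre_digraph \<Rightarrow> bool" where
  "chordal G \<longleftrightarrow>
     (\<forall>p. pre_digraph.cycle (with_proj G) p \<and> 4 \<le> length p \<longrightarrow> (\<exists>e. is_chord G p e))"

subsection \<open>The list of distance eigenvalues has one entry per vertex\<close>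

lemma symmetric_complex_eigenvalue_real:
  fixes A :: "real mat"
  assumes A: "A \<in> carrier_mat n n" and sym: "transpose_mat A = A"
    and ev: "eigenvalue (map_mat complex_of_real A) a"
  shows "a \<in> \<real>"
proof -
  let ?C = "map_mat complex_of_real A"
  have C: "?C \<in> carrier_mat n n" using A by simp
  have symC: "transpose_mat ?C = ?C"
    using arg_cong[OF sym, of "map_mat complex_of_real"] by (simp add: map_mat_transpose)
  obtain v where v: "v \<in> carrier_vec n" "v \<noteq> 0\<^sub>v n" "?C *\<^sub>v v = a \<cdot>\<^sub>v v"
    using ev C unfolding eigenvalue_def eigenvector_def by auto
  have conjv: "conjugate v \<in> carrier_vec n" using v(1) by simp
  have conjCv: "?C *\<^sub>v conjugate v = conjugate (?C *\<^sub>v v)"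
  proof (rule eq_vecI)
    fix i assume "i < dim_vec (conjugate (?C *\<^sub>v v))"
    then have i: "i < n" using A by simp
    then show "(?C *\<^sub>v conjugate v) $ i = conjugate (?C *\<^sub>v v) $ i"
      using A v(1) by (simp add: scalar_prod_def)
  qed simp
  have "a * (v \<bullet> conjugate v) = (?C *\<^sub>v v) \<bullet> conjugate v"
    using v by simp
  also have "\<dots> = v \<bullet> (?C *\<^sub>v conjugate v)"
    using transpose_vec_mult_scalar[OF C v(1) conjv] symC
      comm_scalar_prod[OF conjv, of "?C *\<^sub>v v"] comm_scalar_prod[OF v(1), of "?C *\<^sub>v conjugate v"]
      transpose_vec_mult_scalar[OF C conjv v(1)] C v(1) by (metis mult_mat_vec_carrier)
  also have "\<dots> = cnj a * (v \<bullet> conjugate v)"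
    using conjCv v by (simp add: conjugate_smult_vec)
  finally have "a * (v \<bullet> conjugate v) = cnj a * (v \<bullet> conjugate v)" .
  moreover have "v \<bullet> conjugate v \<noteq> 0"
    using v conjugate_square_eq_0_vec by blast
  ultimately show ?thesis by (simp add: Reals_cnj_iff)
qed

lemma length_eigenvalues_desc:
  assumes A: "A \<in> carrier_mat n n" and sym: "transpose_mat A = A"
  shows "length (eigenvalues_desc A) = n"
proof -
  interpret mp: map_poly_comm_ring_hom complex_of_real ..
  interpret mpi: map_poly_inj_comm_ring_hom complex_of_real ..
  let ?C = "map_mat complex_of_real A"
  have C: "?C \<in> carrier_mat n n" using A by simp
  obtain as where as: "char_poly ?C = (\<Prod>a\<leftarrow>as. [:- a, 1:])" "length as = n"
    using char_poly_factorized[OF C] by auto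
  have "a \<in> \<real>" if "a \<in> set as" for a
  proof (rule symmetric_complex_eigenvalue_real[OF A sym])
    have "poly (char_poly ?C) a = 0"
      unfolding as(1) using that by (induction as) auto
    then show "eigenvalue ?C a" by (simp add: eigenvalue_root_char_poly[OF C])
  qed
  then have bs: "as = map complex_of_real (map Re as)"
    by (induction as) auto
  have lin: "map_poly complex_of_real (\<Prod>b\<leftarrow>xs. [:- b, 1:])
      = (\<Prod>a\<leftarrow>map complex_of_real xs. [:- a, 1:])" for xs
    by (induction xs) (simp_all add: mp.hom_mult del: mult_pCons_left)
  have "map_poly complex_of_real (char_poly A) = char_poly ?C"
    by (simp add: of_real_hom.char_poly_hom[OF A])
  also have "\<dots> = map_poly complex_of_real (\<Prod>b\<leftarrow>map Re as. [:- b, 1:])"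
    unfolding as(1) lin using bs by simp
  finally have "char_poly A = (\<Prod>b\<leftarrow>map Re as. [:- b, 1:])"
    by (rule mpi.injectivity)
  moreover have "size (proots (\<Prod>b\<leftarrow>xs. [:- b, 1:])) = length xs" for xs :: "real list"
  proof (induction xs)
    case (Cons b xs)
    have "(\<Prod>b\<leftarrow>xs. [:- b, 1:]) \<noteq> (0 :: real poly)" by (auto simp: prod_list_zero_iff)
    with Cons show ?case
      using proots_mult[of "[:- b, 1:]"] by (simp del: mult_pCons_left)
  qed simp
  ultimately have "size (proots (char_poly A)) = n" using as(2) by (metis length_map)
  moreover have "length (eigenvalues_desc A) = size (proots (char_poly A))"
    unfolding eigenvalues_desc_def length_rev
    by (metis mset_sorted_list_of_multiset size_mset)
  ultimately show ?thesis by simp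
qed

lemma graph_dist_sym:
  assumes "pair_graph G"
  shows "graph_dist G u v = graph_dist G v u"
proof -
  interpret pair_graph G by fact
  have "\<exists>q. apath y q x \<and> length q = k" if ex: "\<exists>p. apath x p y \<and> length p = k" for x y k
  proof -
    obtain p where p: "apath x p y" "length p = k" using ex by blast
    have "length (rev_path p) = length p" by (induction p) auto
    with p show ?thesis
      unfolding apath_def by (metis awalk_rev_path awalk_verts_rev_path distinct_rev)
  qed
  then show ?thesis unfolding graph_dist_def by metis
qed

lemma length_distance_eigenvalues:
  assumes "pair_graph G" "distinct vs" "set vs = pverts G"
  shows "length (eigenvalues_desc (distance_matrix G vs)) = card (pverts G)"
proof -
  have "transpose_mat (distance_matrix G vs) = distance_matrix G vs"
    by (rule eq_matI) (auto simp: distance_matrix_def graph_dist_sym[OF assms(1)])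
  then have "length (eigenvalues_desc (distance_matrix G vs)) = length vs"
    by (intro length_eigenvalues_desc) (auto simp: distance_matrix_def)
  then show ?thesis using assms(2,3) distinct_card by metis
qed

end

theory Submission
  imports Defs "Jordan_Normal_Form.Schur_Decomposition"
begin

text \<open>
  If two nonzero vectors \<open>f\<close>, \<open>g\<close> are orthogonal both for the standard inner product and for the form
  of a symmetric matrix \<open>A\<close>, and if the form is at least \<open>c\<close> times the squared norm on each of them,
  then it is so on the plane they span, and \<open>\<lambda>\<^sub>2(A) \<ge> c\<close>.  Vectors supported on a few
  vertices therefore bound \<open>\<lambda>\<^sub>2(G)\<close> from below by the distances between these vertices alone.

  Suppose \<open>\<lambda>\<^sub>2(G) < (-3 + sqrt 5) / 2\<close>.  An induced path on four vertices whose ends are at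
  distance 2 would give \<open>\<lambda>\<^sub>2 \<ge> (-3 + sqrt 5) / 2\<close>, so there is none.  If \<open>G\<close> is not chordal,
  take a shortest induced cycle \<open>C\<close> of length at least 4.  It is isometric: given a shortest path
  \<open>w\<^sub>0 w\<^sub>1 w\<^sub>2 \<dots>\<close> that shortcuts \<open>C\<close>, it closes up with either arc of \<open>C\<close> to a
  cycle shorter than \<open>C\<close>, in which every edge lies in a triangle; hence \<open>w\<^sub>1\<close> and then
  \<open>w\<^sub>2\<close> are adjacent to both neighbours of \<open>w\<^sub>0\<close> on \<open>C\<close>, which forces \<open>w\<^sub>2\<close> to be
  adjacent to \<open>w\<^sub>0\<close>.  On an isometric cycle of length 5 there is a forbidden path; on any other one,
  four or six vertices carry suitable test vectors.
\<close>

section \<open>Diagonalisation and the second eigenvalue of a real symmetric matrix\<close>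

text \<open>Gram-Schmidt keeps the first vector of a basis completing \<open>v\<close>; normalising
  the result gives the columns of \<open>W\<close>, and \<open>c\<close> is the norm of
  \<open>v\<close>.\<close>

lemma orthogonal_matrix_with_first_column:
  fixes v :: "real vec"
  assumes v: "v \<in> carrier_vec n" and v0: "v \<noteq> 0\<^sub>v n"
  obtains W c where "W \<in> carrier_mat n n" "transpose_mat W * W = 1\<^sub>m n" "v = c \<cdot>\<^sub>v col W 0"
proof -
  interpret cof_vec_space n "TYPE(real)" .
  have n: "n > 0"
    using v v0 by (cases n) auto
  define b where "b = basis_completion v"
  define ws where "ws = gram_schmidt n b"
  have b: "span (set b) = carrier_vec n" "distinct b" "\<not> lin_dep (set b)"
      "set b \<subseteq> carrier_vec n" "hd b = v" "length b = n"
    using basis_completion[OF v v0, folded b_def] by auto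
  then obtain vs where bv: "b = v # vs"
    using n by (cases b) auto
  have ws: "set ws \<subseteq> carrier_vec n" "corthogonal ws" "length ws = n"
    using gram_schmidt_result[OF b(4) b(2) b(3) refl, folded ws_def] b(6) by auto
  have ws0: "ws ! 0 = v"
    using gram_schmidt_hd[OF v, of vs] ws(3) n by (metis bv hd_conv_nth length_greater_0_conv ws_def)
  have carr: "ws ! i \<in> carrier_vec n" if "i < n" for i
    using that ws by auto
  have orth: "(ws ! i \<bullet> ws ! j = 0) \<longleftrightarrow> i \<noteq> j" if "i < n" "j < n" for i j
    using corthogonalD[OF ws(2), of i j] that ws(3) by simp
  have pos: "ws ! i \<bullet> ws ! i > 0" if "i < n" for i
  proof -
    have "0 \<le> ws ! i \<bullet> ws ! i"
      unfolding scalar_prod_def by (intro sum_nonneg) simp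
    then show ?thesis using orth[OF that that] by simp
  qed
  define W where "W = mat_of_cols n (map (\<lambda>w. (1 / sqrt (w \<bullet> w)) \<cdot>\<^sub>v w) ws)"
  have W: "W \<in> carrier_mat n n"
    using ws(3) by (simp add: W_def mat_of_cols_def)
  have colW: "col W i = (1 / sqrt (ws ! i \<bullet> ws ! i)) \<cdot>\<^sub>v ws ! i" if "i < n" for i
    unfolding W_def using that ws(3) carr by (subst col_mat_of_cols) auto
  have "transpose_mat W * W = 1\<^sub>m n"
  proof (rule eq_matI)
    fix i j assume ij: "i < dim_row (1\<^sub>m n :: real mat)" "j < dim_col (1\<^sub>m n :: real mat)"
    then have "(transpose_mat W * W) $$ (i, j) = col W i \<bullet> col W j"
      using W by simp
    also have "\<dots> = (1\<^sub>m n :: real mat) $$ (i, j)"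
      using ij colW carr[of i] carr[of j] orth[of i j] pos[of i]
      by (cases "i = j") simp_all
    finally show "(transpose_mat W * W) $$ (i, j) = (1\<^sub>m n :: real mat) $$ (i, j)" .
  qed (use W in auto)
  moreover have "v = sqrt (v \<bullet> v) \<cdot>\<^sub>v col W 0"
    using colW[OF n] pos[OF n] by (simp add: ws0 smult_smult_assoc)
  ultimately show ?thesis
    using that W by blast
qed

text \<open>The characteristic polynomial has a complex root, and symmetry forces this root to be
  real.\<close>

lemma real_symmetric_eigenvalue_exists:
  fixes A :: "real mat"
  assumes A: "A \<in> carrier_mat n n" and sym: "transpose_mat A = A" and n: "n > 0"
  obtains e where "eigenvalue A e"
proof -
  let ?C = "map_mat complex_of_real A"
  have C: "?C \<in> carrier_mat n n" using A by simp
  have "degree (char_poly ?C) = n"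
    using degree_monic_char_poly[OF C] by simp
  then have "\<not> constant (poly (char_poly ?C))"
    using n by (simp add: constant_degree)
  then obtain z where z: "poly (char_poly ?C) z = 0"
    using fundamental_theorem_of_algebra by blast
  then have "z \<in> \<real>"
    using symmetric_complex_eigenvalue_real[OF A sym] by (simp add: eigenvalue_root_char_poly[OF C])
  then obtain e where e: "z = of_real e"
    by (auto elim: Reals_cases)
  have "poly (map_poly complex_of_real (char_poly A)) (of_real e) = 0"
    using z e by (simp add: of_real_hom.char_poly_hom[OF A])
  then have "poly (char_poly A) e = 0"
    by (simp add: of_real_hom.poly_map_poly)
  then show ?thesis
    using that by (simp add: eigenvalue_root_char_poly[OF A])
qed

text \<open>Deflation: conjugating by an orthogonal matrix whose first column is an eigenvector
  splits off one eigenvalue, and the induction hypothesis diagonalises the remaining symmetric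
  block.\<close>

theorem real_symmetric_diagonalisation:
  fixes A :: "real mat"
  assumes "A \<in> carrier_mat n n" "transpose_mat A = A"
  shows "\<exists>P es. P \<in> carrier_mat n n \<and> length es = n \<and> transpose_mat P * P = 1\<^sub>m n
    \<and> transpose_mat P * A * P = mat n n (\<lambda>(i, j). if i = j then es ! i else 0)"
  using assms
proof (induction n arbitrary: A)
  case 0
  have "A = 0\<^sub>m 0 0" using 0 by auto
  then show ?case by (intro exI[of _ "1\<^sub>m 0"] exI[of _ "[]"]) auto
next
  case (Suc n A)
  note A = Suc.prems(1) and sym = Suc.prems(2)
  obtain e where "eigenvalue A e"
    using real_symmetric_eigenvalue_exists[OF A sym] by auto
  then obtain v where v: "v \<in> carrier_vec (Suc n)" "v \<noteq> 0\<^sub>v (Suc n)" "A *\<^sub>v v = e \<cdot>\<^sub>v v"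
    using A unfolding eigenvalue_def eigenvector_def by auto
  obtain W c where W: "W \<in> carrier_mat (Suc n) (Suc n)" and WW: "transpose_mat W * W = 1\<^sub>m (Suc n)"
    and vW: "v = c \<cdot>\<^sub>v col W 0"
    using orthogonal_matrix_with_first_column[OF v(1,2)] .
  have tW: "transpose_mat W \<in> carrier_mat (Suc n) (Suc n)" using W by simp
  have w: "col W 0 \<in> carrier_vec (Suc n)" using W by (intro col_carrier_vec[of _ "Suc n"]) auto
  \<comment> \<open>This allows dividing the eigenvector equation by \<open>c\<close>, so that the
    unit column itself is an eigenvector.\<close>
  have c0: "c \<noteq> 0" 
  proof
    assume "c = 0"
    then have "v = 0\<^sub>v (Suc n)"
      using vW carrier_matD[OF W] by (intro eq_vecI) auto
    with v(2) show False ..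
  qed
  have "c \<cdot>\<^sub>v (A *\<^sub>v col W 0) = c \<cdot>\<^sub>v (e \<cdot>\<^sub>v col W 0)"
    using v(3) vW A w by (simp add: mult_mat_vec smult_smult_assoc mult.commute)
  then have "(1 / c) \<cdot>\<^sub>v (c \<cdot>\<^sub>v (A *\<^sub>v col W 0)) = (1 / c) \<cdot>\<^sub>v (c \<cdot>\<^sub>v (e \<cdot>\<^sub>v col W 0))" by simp
  then have Aw: "A *\<^sub>v col W 0 = e \<cdot>\<^sub>v col W 0"
    using c0 A by (simp add: smult_smult_assoc)
  define B where "B = transpose_mat W * A * W"
  have B: "B \<in> carrier_mat (Suc n) (Suc n)" using W A by (simp add: B_def)
  have symB: "transpose_mat B = B"
    unfolding B_def using W A sym
    by (simp add: transpose_mult[of _ "Suc n" "Suc n" _ "Suc n"] assoc_mult_mat[of _ "Suc n" "Suc n" _ "Suc n" _ "Suc n"])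
  have B_ij: "B $$ (i, j) = col W i \<bullet> (A *\<^sub>v col W j)" if "i < Suc n" "j < Suc n" for i j
  proof -
    have "B = transpose_mat W * (A * W)"
      unfolding B_def using W A by (simp add: assoc_mult_mat[of _ "Suc n" "Suc n" _ "Suc n" _ "Suc n"])
    moreover have "col (A * W) j = A *\<^sub>v col W j"
      using that A W by (intro col_mult2) auto
    ultimately show ?thesis using that W A by simp
  qed
  have WW_ij: "col W i \<bullet> col W j = (if i = j then 1 else 0)" if "i < Suc n" "j < Suc n" for i j
    using arg_cong[OF WW, of "\<lambda>M. M $$ (i, j)"] that W by simp
  \<comment> \<open>The first column comes from the eigenvector equation and orthonormality; the
    first row then follows from the symmetry of \<open>B\<close>.\<close>
  have B_i0: "B $$ (i, 0) = (if i = 0 then e else 0)" if "i < Suc n" for i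
  proof -
    have "col W i \<in> carrier_vec (Suc n)" using that W by auto
    then show ?thesis
      using B_ij[of i 0] WW_ij[of i 0] that w Aw by simp
  qed
  have B_0i: "B $$ (0, i) = (if i = 0 then e else 0)" if "i < Suc n" for i
    using B_i0[OF that] arg_cong[OF symB, of "\<lambda>M. M $$ (i, 0)"] that B by simp
  define B3 where "B3 = mat n n (\<lambda>(i, j). B $$ (Suc i, Suc j))"
  define E where "E = mat 1 1 (\<lambda>_. e)"
  have E: "E \<in> carrier_mat 1 1" by (simp add: E_def)
  have B3: "B3 \<in> carrier_mat n n" by (simp add: B3_def)
  have B_block: "B = four_block_mat E (0\<^sub>m 1 n) (0\<^sub>m n 1) B3"
    by (rule eq_matI) (use B B_i0 B_0i in \<open>auto simp: E_def B3_def\<close>)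
  have "transpose_mat B3 = B3"
  proof (rule eq_matI)
    fix i j assume "i < dim_row B3" "j < dim_col B3"
    then show "transpose_mat B3 $$ (i, j) = B3 $$ (i, j)"
      using arg_cong[OF symB, of "\<lambda>M. M $$ (Suc i, Suc j)"] B by (simp add: B3_def)
  qed (simp_all add: B3_def)
  from Suc.IH[OF B3 this] obtain P es where
    P: "P \<in> carrier_mat n n" and es: "length es = n" and PP: "transpose_mat P * P = 1\<^sub>m n"
    and PBP: "transpose_mat P * B3 * P = mat n n (\<lambda>(i, j). if i = j then es ! i else 0)" by blast
  define F where "F = four_block_mat (1\<^sub>m 1) (0\<^sub>m 1 n) (0\<^sub>m n 1) P"
  have F: "F \<in> carrier_mat (Suc n) (Suc n)"
    using P four_block_carrier_mat[of "1\<^sub>m 1" 1 1 P n n] by (simp add: F_def)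
  have tF: "transpose_mat F = four_block_mat (1\<^sub>m 1) (0\<^sub>m 1 n) (0\<^sub>m n 1) (transpose_mat P)"
    unfolding F_def using P by (subst transpose_four_block_mat) auto
  have tP: "transpose_mat P \<in> carrier_mat n n" using P by simp
  have tFF: "transpose_mat F \<in> carrier_mat (Suc n) (Suc n)" using F by simp
  have FF: "transpose_mat F * F = 1\<^sub>m (Suc n)"
    unfolding tF unfolding F_def using P PP
    by (subst mult_four_block_mat[of _ 1 1 _ n _ n _ _ 1 _ n]) auto
  have "transpose_mat F * B = four_block_mat E (0\<^sub>m 1 n) (0\<^sub>m n 1) (transpose_mat P * B3)"
    unfolding tF B_block using P E B3
    by (subst mult_four_block_mat[of _ 1 1 _ n _ n _ _ 1 _ n]) auto
  then have "transpose_mat F * B * F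
      = four_block_mat E (0\<^sub>m 1 n) (0\<^sub>m n 1) (transpose_mat P * B3 * P)"
    unfolding F_def using P E B3
    by (simp, subst mult_four_block_mat[of _ 1 1 _ n _ n _ _ 1 _ n]) auto
  also have "\<dots> = mat (Suc n) (Suc n) (\<lambda>(i, j). if i = j then (e # es) ! i else 0)"
    unfolding PBP by (rule eq_matI) (auto simp: E_def nth_Cons')
  finally have D: "transpose_mat F * B * F
      = mat (Suc n) (Suc n) (\<lambda>(i, j). if i = j then (e # es) ! i else 0)" .
  note assoc = assoc_mult_mat[of _ "Suc n" "Suc n" _ "Suc n" _ "Suc n"]
  have tWF: "transpose_mat (W * F) = transpose_mat F * transpose_mat W"
    using W F by (rule transpose_mult)
  have "transpose_mat (W * F) * (W * F) = transpose_mat F * (transpose_mat W * W) * F"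
    unfolding tWF using W F tW tFF by (simp add: assoc)
  also have "\<dots> = 1\<^sub>m (Suc n)" unfolding WW using FF tFF by simp
  finally have 1: "transpose_mat (W * F) * (W * F) = 1\<^sub>m (Suc n)" .
  have "transpose_mat (W * F) * A * (W * F) = transpose_mat F * B * F"
    unfolding tWF B_def using W F tW tFF A by (simp add: assoc)
  with D have 2: "transpose_mat (W * F) * A * (W * F)
      = mat (Suc n) (Suc n) (\<lambda>(i, j). if i = j then (e # es) ! i else 0)" by simp
  have "W * F \<in> carrier_mat (Suc n) (Suc n)" using W F by simp
  with 1 2 es show ?case
    by (intro exI[of _ "W * F"] exI[of _ "e # es"]) auto
qed

section \<open>Eigenvalues read off a diagonalisation, and the two-vector bound\<close>

lemma proots_linear_factors:
  fixes xs :: "real list"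
  shows "proots (\<Prod>b\<leftarrow>xs. [:- b, 1:]) = mset xs"
proof (induction xs)
  case (Cons b xs)
  have "(\<Prod>b\<leftarrow>xs. [:- b, 1:]) \<noteq> (0 :: real poly)" by (auto simp: prod_list_zero_iff)
  with Cons show ?case
    using proots_mult[of "[:- b, 1:]"] by (simp del: mult_pCons_left)
qed simp

text \<open>\<open>P\<close> is orthogonal, so \<open>A\<close> is similar to the diagonal matrix
  and has the same characteristic polynomial. Multisets are compared because \<open>es\<close> comes
  in no particular order.\<close>

lemma mset_eigenvalues_desc:
  fixes A P :: "real mat"
  assumes A: "A \<in> carrier_mat n n" and P: "P \<in> carrier_mat n n" and es: "length es = n"
    and PP: "transpose_mat P * P = 1\<^sub>m n"
    and PAP: "transpose_mat P * A * P = mat n n (\<lambda>(i, j). if i = j then es ! i else 0)" (is "_ = ?D")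
  shows "mset (eigenvalues_desc A) = mset es"
proof -
  have tP: "transpose_mat P \<in> carrier_mat n n" using P by simp
  have PP': "P * transpose_mat P = 1\<^sub>m n"
    by (rule mat_mult_left_right_inverse[OF tP P PP])
  note assoc = assoc_mult_mat[of _ n n _ n _ n]
  have "P * (transpose_mat P * A * P) * transpose_mat P = (P * transpose_mat P) * A * (P * transpose_mat P)"
    using A P tP by (simp add: assoc)
  then have "A = P * ?D * transpose_mat P"
    unfolding PAP PP' using A by simp
  then have "similar_mat_wit A ?D P (transpose_mat P)"
    using A P tP PP PP' by (intro similar_mat_witI[of _ _ n]) auto
  then have "char_poly A = char_poly ?D"
    by (intro char_poly_similar) (auto simp: similar_mat_def)
  also have "\<dots> = (\<Prod>a\<leftarrow>diag_mat ?D. [:- a, 1:])"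
    by (rule char_poly_upper_triangular[of _ n]) auto
  also have "diag_mat ?D = es"
    using es by (auto simp: diag_mat_def intro: nth_equalityI)
  finally show ?thesis
    by (simp add: eigenvalues_desc_def proots_linear_factors)
qed

lemma quadratic_form_diag:
  fixes A P :: "real mat"
  assumes A: "A \<in> carrier_mat n n" and P: "P \<in> carrier_mat n n"
    and PP: "transpose_mat P * P = 1\<^sub>m n"
    and PAP: "transpose_mat P * A * P = mat n n (\<lambda>(i, j). if i = j then es ! i else 0)" (is "_ = ?D")
    and z: "z \<in> carrier_vec n"
  defines "u \<equiv> transpose_mat P *\<^sub>v z"
  shows "z \<bullet> (A *\<^sub>v z) = (\<Sum>i<n. es ! i * (u $ i)\<^sup>2)" and "z \<bullet> z = (\<Sum>i<n. (u $ i)\<^sup>2)"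
proof -
  have tP: "transpose_mat P \<in> carrier_mat n n" using P by simp
  have u: "u \<in> carrier_vec n" using tP z by (simp add: u_def)
  have PP': "P * transpose_mat P = 1\<^sub>m n"
    by (rule mat_mult_left_right_inverse[OF tP P PP])
  have zu: "z = P *\<^sub>v u"
    unfolding u_def using assoc_mult_mat_vec[OF P tP z] PP' z by simp
  have 1: "z \<bullet> (P *\<^sub>v y) = u \<bullet> y" if "y \<in> carrier_vec n" for y
    unfolding u_def using transpose_vec_mult_scalar[OF P that z] by simp
  have "z \<bullet> z = u \<bullet> u"
    using 1[OF u] zu by simp
  then show "z \<bullet> z = (\<Sum>i<n. (u $ i)\<^sup>2)"
    using u by (simp add: scalar_prod_def power2_eq_square lessThan_atLeast0)
  have "z \<bullet> (A *\<^sub>v z) = (transpose_mat A *\<^sub>v z) \<bullet> (P *\<^sub>v u)"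
    using transpose_vec_mult_scalar[OF A z z] zu by simp
  also have "\<dots> = (transpose_mat P *\<^sub>v (transpose_mat A *\<^sub>v z)) \<bullet> u"
    using transpose_vec_mult_scalar[OF P u] A z by simp
  also have "transpose_mat P *\<^sub>v (transpose_mat A *\<^sub>v z) = transpose_mat (transpose_mat P * A * P) *\<^sub>v u"
    using A P tP u zu
    by (simp add: transpose_mult[of _ n n _ n] assoc_mult_mat_vec[of _ n n _ n])
  also have "\<dots> = vec n (\<lambda>i. es ! i * u $ i)"
    unfolding PAP using u by (intro eq_vecI) (auto simp: scalar_prod_def if_distrib[of "\<lambda>x. x * _"] cong: if_cong)
  also have "\<dots> \<bullet> u = (\<Sum>i<n. es ! i * (u $ i)\<^sup>2)"
    using u by (simp add: scalar_prod_def power2_eq_square lessThan_atLeast0 mult.assoc)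
  finally show "z \<bullet> (A *\<^sub>v z) = (\<Sum>i<n. es ! i * (u $ i)\<^sup>2)" .
qed

text \<open>In a descending list whose entry at position 1 is below \<open>c\<close>, only the head
  can reach \<open>c\<close>; the number of entries reaching \<open>c\<close> depends only on the
  multiset.\<close>

lemma second_eigenvalue_less_imp_unique:
  assumes es: "mset (eigenvalues_desc A) = mset es" and "2 \<le> length es"
    and less: "eigenvalues_desc A ! 1 < c"
    and ij: "i < length es" "j < length es" "c \<le> es ! i" "c \<le> es ! j"
  shows "i = j"
proof (rule ccontr)
  assume "i \<noteq> j"
  define ds where "ds = eigenvalues_desc A"
  have len: "length ds = length es"
    using es mset_eq_length ds_def by blast
  then obtain a b rest where ds: "ds = a # b # rest"
    using assms(2) by (metis One_nat_def Suc_1 Suc_le_length_iff)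
  have "sorted_wrt (\<ge>) ds"
    unfolding ds_def eigenvalues_desc_def by (simp add: sorted_wrt_rev)
  then have "\<forall>x\<in>set (b # rest). x < c"
    using less unfolding ds_def[symmetric] ds by auto
  then have "length (filter (\<lambda>x. c \<le> x) ds) \<le> 1"
    unfolding ds by (auto simp: filter_empty_conv not_le)
  moreover have "length (filter (\<lambda>x. c \<le> x) ds) = length (filter (\<lambda>x. c \<le> x) es)"
    using es unfolding ds_def by (metis mset_filter size_mset)
  moreover have "length (filter (\<lambda>x. c \<le> x) es) = card {k. k < length es \<and> c \<le> es ! k}"
    by (rule length_filter_conv_card)
  moreover have "card {i, j} \<le> card {k. k < length es \<and> c \<le> es ! k}"
    using ij by (intro card_mono) auto
  ultimately show False using \<open>i \<noteq> j\<close> by simp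
qed

text \<open>One half of the Courant-Fischer principle. Otherwise at most one eigenvalue reaches
  \<open>c\<close>, and the plane of \<open>f\<close> and \<open>g\<close> contains a nonzero vector
  without component along its eigenvector; there the form is too small.\<close>

lemma second_eigenvalue_ge:
  fixes A :: "real mat"
  assumes A: "A \<in> carrier_mat n n" and sym: "transpose_mat A = A" and n: "2 \<le> n"
    and f: "f \<in> carrier_vec n" "f \<noteq> 0\<^sub>v n" and g: "g \<in> carrier_vec n" "g \<noteq> 0\<^sub>v n"
    and fg: "f \<bullet> g = 0" "f \<bullet> (A *\<^sub>v g) = 0"
    and ff: "c * (f \<bullet> f) \<le> f \<bullet> (A *\<^sub>v f)" and gg: "c * (g \<bullet> g) \<le> g \<bullet> (A *\<^sub>v g)"
  shows "c \<le> eigenvalues_desc A ! 1"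
proof (rule ccontr)
  assume "\<not> ?thesis"
  then have less: "eigenvalues_desc A ! 1 < c" by simp
  obtain P es where P: "P \<in> carrier_mat n n" and es: "length es = n"
    and PP: "transpose_mat P * P = 1\<^sub>m n"
    and PAP: "transpose_mat P * A * P = mat n n (\<lambda>(i, j). if i = j then es ! i else 0)"
    using real_symmetric_diagonalisation[OF A sym] by blast
  have uniq: "i = j" if "i < n" "j < n" "c \<le> es ! i" "c \<le> es ! j" for i j
    using second_eigenvalue_less_imp_unique[OF mset_eigenvalues_desc[OF A P es PP PAP] _ less] that n es
    by auto
  \<comment> \<open>If no entry of \<open>es\<close> reaches \<open>c\<close>, any \<open>k\<close>
    will do; it is not known to be an index, hence the guards \<open>k < n\<close> below.\<close>
  obtain k where k: "\<And>i. i < n \<Longrightarrow> i \<noteq> k \<Longrightarrow> es ! i < c"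
    using uniq by (metis not_le)
  have tP: "transpose_mat P \<in> carrier_mat n n" using P by simp
  \<comment> \<open>One linear equation in two unknowns: the combination is to have coordinate 0 at
    \<open>k\<close>.\<close>
  obtain a b :: real where ab: "a \<noteq> 0 \<or> b \<noteq> 0"
    and abk: "k < n \<Longrightarrow> a * (transpose_mat P *\<^sub>v f) $ k + b * (transpose_mat P *\<^sub>v g) $ k = 0"
  proof (cases "k < n \<and> (transpose_mat P *\<^sub>v f) $ k \<noteq> 0")
    case True
    then show ?thesis
      using that[of "(transpose_mat P *\<^sub>v g) $ k" "- (transpose_mat P *\<^sub>v f) $ k"] by simp
  next
    case False
    then show ?thesis using that[of 1 0] by auto
  qed
  define z where "z = a \<cdot>\<^sub>v f + b \<cdot>\<^sub>v g"
  have z: "z \<in> carrier_vec n" using f g by (simp add: z_def)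
  define u where "u = transpose_mat P *\<^sub>v z"
  have u_eq: "u = a \<cdot>\<^sub>v (transpose_mat P *\<^sub>v f) + b \<cdot>\<^sub>v (transpose_mat P *\<^sub>v g)"
    unfolding u_def z_def using tP f g
    by (simp add: mult_add_distrib_mat_vec[OF tP] mult_mat_vec[OF tP])
  have uk: "u $ k = 0" if "k < n"
    unfolding u_eq using that abk tP f g by simp
  have gf: "g \<bullet> f = 0" using fg(1) comm_scalar_prod[OF f(1) g(1)] by simp
  have Af: "A *\<^sub>v f \<in> carrier_vec n" and Ag: "A *\<^sub>v g \<in> carrier_vec n" using A f g by auto
  have gAf: "g \<bullet> (A *\<^sub>v f) = 0"
    using transpose_vec_mult_scalar[OF A f(1) g(1)] transpose_vec_mult_scalar[OF A g(1) f(1)] sym fg(2)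
      comm_scalar_prod[OF f(1) Ag] by simp
  have zz: "z \<bullet> z = a\<^sup>2 * (f \<bullet> f) + b\<^sup>2 * (g \<bullet> g)"
    unfolding z_def using f g fg gf
    by (simp add: add_scalar_prod_distrib[of _ n] scalar_prod_add_distrib[of _ n] power2_eq_square)
  have zAz: "z \<bullet> (A *\<^sub>v z) = a\<^sup>2 * (f \<bullet> (A *\<^sub>v f)) + b\<^sup>2 * (g \<bullet> (A *\<^sub>v g))"
    unfolding z_def using f g fg gAf Af Ag
    by (simp add: mult_add_distrib_mat_vec[OF A] mult_mat_vec[OF A] add_scalar_prod_distrib[of _ n]
        scalar_prod_add_distrib[of _ n] power2_eq_square)
  have pos: "0 < f \<bullet> f" "0 < g \<bullet> g"
    using f g conjugate_square_greater_0_vec[OF f(1)] conjugate_square_greater_0_vec[OF g(1)] by auto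
  have "0 < z \<bullet> z"
    unfolding zz using ab pos by (cases "a = 0") (auto intro: add_pos_nonneg mult_nonneg_nonneg)
  moreover have "c * (z \<bullet> z) \<le> z \<bullet> (A *\<^sub>v z)"
  proof -
    have "a\<^sup>2 * (c * (f \<bullet> f)) + b\<^sup>2 * (c * (g \<bullet> g)) \<le> z \<bullet> (A *\<^sub>v z)"
      unfolding zAz using ff gg by (intro add_mono mult_left_mono) auto
    then show ?thesis unfolding zz by (simp add: algebra_simps)
  qed
  moreover have "z \<bullet> (A *\<^sub>v z) = (\<Sum>i<n. es ! i * (u $ i)\<^sup>2)" "z \<bullet> z = (\<Sum>i<n. (u $ i)\<^sup>2)"
    unfolding u_def by (rule quadratic_form_diag[OF A P PP PAP z])+
  ultimately have "0 < (\<Sum>i<n. (u $ i)\<^sup>2)" and le: "(\<Sum>i<n. c * (u $ i)\<^sup>2) \<le> (\<Sum>i<n. es ! i * (u $ i)\<^sup>2)"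
    by (simp_all add: sum_distrib_left)
  \<comment> \<open>Coordinate \<open>k\<close> vanishes, so this \<open>i\<close> differs from
    \<open>k\<close> and supplies the strict inequality.\<close>
  then obtain i where i: "i < n" "u $ i \<noteq> 0"
    by (metis (no_types, lifting) lessThan_iff less_irrefl power_zero_numeral sum.neutral)
  have term_le: "es ! j * (u $ j)\<^sup>2 \<le> c * (u $ j)\<^sup>2" if "j < n" for j
    using k[OF that] uk that by (cases "j = k") (auto intro!: mult_right_mono)
  have "es ! i * (u $ i)\<^sup>2 < c * (u $ i)\<^sup>2"
    using k[OF i(1)] i uk by (cases "i = k") auto
  then have "(\<Sum>i<n. es ! i * (u $ i)\<^sup>2) < (\<Sum>i<n. c * (u $ i)\<^sup>2)"
    using i(1) term_le by (intro sum_strict_mono_ex1) auto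
  with le show False by simp
qed

section \<open>Distances and geodesics\<close>

context pair_graph
begin

text \<open>Powers of the arc relation stand in for walks from here on, since they compose without
  reference to arc lists.\<close>

lemma awalk_imp_relpow: "awalk u p v \<Longrightarrow> (u, v) \<in> parcs G ^^ length p"
proof (induction p arbitrary: u)
  case (Cons e p)
  then have "(u, snd e) \<in> parcs G" "(snd e, v) \<in> parcs G ^^ length p"
    by (auto simp: awalk_Cons_iff)
  from relpow_Suc_I2[OF this] show ?case by simp
qed (simp add: awalk_Nil_iff)

lemma relpow_imp_awalk:
  assumes "(u, v) \<in> parcs G ^^ k" "u \<in> pverts G"
  shows "\<exists>p. awalk u p v \<and> length p = k"
  using assms
proof (induction k arbitrary: u)
  case (Suc k)
  obtain w where w: "(u, w) \<in> parcs G" "(w, v) \<in> parcs G ^^ k"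
    using Suc.prems(1) by (rule relpow_Suc_E2) auto
  then obtain p where "awalk w p v" "length p = k"
    using Suc.IH in_arcsD2 by blast
  then show ?case
    using w by (intro exI[of _ "(u, w) # p"]) (auto simp: awalk_Cons_iff)
qed (auto simp: awalk_Nil_iff)

text \<open>Distance is a minimum over paths without repeated vertices, while upper bounds come from
  arbitrary walks; cutting out closed subwalks never lengthens a walk.\<close>

lemma length_awalk_to_apath_le: "awalk u p v \<Longrightarrow> length (awalk_to_apath p) \<le> length p"
proof (induction rule: awalk_to_apath_induct)
  case (path p)
  then show ?case by (subst awalk_to_apath.simps) auto
next
  case (decomp p q r s)
  then have "p = q @ r @ s" by (auto elim: awalk_cyc_decompE)
  then show ?case
    using decomp step_awalk_to_apath[of _ p _ q r s] by auto
qed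

lemma graph_dist_le:
  assumes "(u, v) \<in> parcs G ^^ k" "u \<in> pverts G"
  shows "graph_dist G u v \<le> k"
proof -
  obtain p where p: "awalk u p v" "length p = k"
    using relpow_imp_awalk[OF assms] by blast
  have "graph_dist G u v \<le> length (awalk_to_apath p)"
    unfolding graph_dist_def using apath_awalk_to_apath[OF p(1)] by (intro Least_le) blast
  with length_awalk_to_apath_le[OF p(1)] p(2) show ?thesis by simp
qed

end

locale connected_pair_graph = pair_graph +
  assumes conn: "Digraph_Component.connected (with_proj G)"
begin

abbreviation adj :: "'a \<Rightarrow> 'a \<Rightarrow> bool" (infix "\<sim>" 50) where
  "u \<sim> v \<equiv> (u, v) \<in> parcs G"

abbreviation dist :: "'a \<Rightarrow> 'a \<Rightarrow> nat" where
  "dist \<equiv> graph_dist G"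

lemma adj_sym: "u \<sim> v \<longleftrightarrow> v \<sim> u"
  using arcs_symmetric by blast

lemma not_adj_self [simp]: "\<not> u \<sim> u"
  using no_loops' by blast

text \<open>Connectedness provides some path, so the \<open>LEAST\<close> in
  \<open>graph_dist\<close> is attained.\<close>

lemma relpow_dist:
  assumes "u \<in> pverts G" "v \<in> pverts G"
  shows "(u, v) \<in> parcs G ^^ dist u v"
proof -
  have "strongly_connected (with_proj G)"
    using symmetric_connected_imp_strongly_connected[OF sym_arcs conn] .
  then have "u \<rightarrow>\<^sup>*\<^bsub>with_proj G\<^esub> v"
    using assms by (simp add: strongly_connected_def)
  then have "\<exists>k p. apath u p v \<and> length p = k"
    by (simp add: reachable_apath)
  then have "\<exists>p. apath u p v \<and> length p = dist u v"
    unfolding graph_dist_def by (rule LeastI_ex)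
  then show ?thesis
    using awalk_imp_relpow awalkI_apath by metis
qed

lemma dist_triangle:
  assumes "u \<in> pverts G" "v \<in> pverts G" "w \<in> pverts G"
  shows "dist u w \<le> dist u v + dist v w"
proof (rule graph_dist_le)
  show "(u, w) \<in> parcs G ^^ (dist u v + dist v w)"
    using relpow_dist[of u v] relpow_dist[of v w] assms unfolding relpow_add by blast
qed (rule assms(1))

lemma dist_sym: "dist u v = dist v u"
  by (rule graph_dist_sym) (rule pair_graph)

lemma dist_self [simp]: "u \<in> pverts G \<Longrightarrow> dist u u = 0"
  using graph_dist_le[of u u 0] by simp

lemma dist_eq_0: "u \<in> pverts G \<Longrightarrow> v \<in> pverts G \<Longrightarrow> dist u v = 0 \<longleftrightarrow> u = v"
  using relpow_dist[of u v] by auto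

lemma dist_eq_1: "u \<in> pverts G \<Longrightarrow> v \<in> pverts G \<Longrightarrow> dist u v = 1 \<longleftrightarrow> u \<sim> v"
  using relpow_dist[of u v] graph_dist_le[of u v 1] dist_eq_0[of u v]
  by (auto simp: le_Suc_eq)

lemma dist_le_2:
  assumes "u \<sim> v" "v \<sim> w"
  shows "dist u w \<le> 2"
proof (rule graph_dist_le)
  show "(u, w) \<in> parcs G ^^ 2"
    using assms by (auto simp: numeral_2_eq_2)
  show "u \<in> pverts G" using assms(1) by (rule in_arcsD1)
qed

lemma dist_eq_2:
  assumes "u \<sim> v" "v \<sim> w" "u \<noteq> w" "\<not> u \<sim> w"
  shows "dist u w = 2"
proof -
  have "u \<in> pverts G" "w \<in> pverts G" using assms wellformed' by blast+
  then show ?thesis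
    using dist_le_2[OF assms(1,2)] dist_eq_0[of u w] dist_eq_1[of u w] assms(3,4) by linarith
qed

text \<open>Prescribing all pairwise distances, not only the one between the ends, makes adjacency
  and injectivity along \<open>w\<close> immediate.\<close>

definition geodesic :: "nat \<Rightarrow> (nat \<Rightarrow> 'a) \<Rightarrow> bool" where
  "geodesic n w \<longleftrightarrow> (\<forall>i\<le>n. w i \<in> pverts G) \<and>
    (\<forall>i j. i \<le> j \<and> j \<le> n \<longrightarrow> dist (w i) (w j) = j - i)"

lemma geodesic_exists:
  assumes "u \<in> pverts G" "v \<in> pverts G"
  obtains w where "geodesic (dist u v) w" "w 0 = u" "w (dist u v) = v"
proof -
  define n where "n = dist u v"
  obtain w where w: "w 0 = u" "w n = v" "\<And>i. i < n \<Longrightarrow> w i \<sim> w (Suc i)"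
    using relpow_dist[OF assms] unfolding relpow_fun_conv n_def by blast
  have V: "w i \<in> pverts G" if "i \<le> n" for i
  proof (cases "i = n")
    case False
    then show ?thesis using that in_arcsD1[OF w(3)[of i]] by simp
  qed (use assms w in simp)
  have le: "dist (w i) (w j) \<le> j - i" if "i \<le> j" "j \<le> n" for i j
  proof (rule graph_dist_le)
    show "(w i, w j) \<in> parcs G ^^ (j - i)"
      unfolding relpow_fun_conv using that w(3) by (intro exI[of _ "\<lambda>l. w (i + l)"]) auto
  qed (use V that in auto)
  \<comment> \<open>Going from \<open>w 0\<close> to \<open>w n\<close> through \<open>w i\<close>
    and \<open>w j\<close> takes at least \<open>n\<close> steps, and the two outer pieces take at
    most \<open>i\<close> and \<open>n - j\<close>.\<close>
  have "dist (w i) (w j) = j - i" if ij: "i \<le> j" "j \<le> n" for i j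
  proof -
    have "n \<le> dist (w 0) (w i) + dist (w i) (w n)"
      using dist_triangle[of "w 0" "w i" "w n"] V[of 0] V[of i] V[of n] ij w(1,2)
      by (metis le0 le_trans n_def order_refl)
    also have "dist (w i) (w n) \<le> dist (w i) (w j) + dist (w j) (w n)"
      using dist_triangle[of "w i" "w j" "w n"] V ij by simp
    finally have "n \<le> i + dist (w i) (w j) + (n - j)"
      using le[of 0 i] le[of j n] ij by simp
    with le[OF ij] ij show ?thesis by simp
  qed
  then show ?thesis
    using that[of w] w V by (simp add: geodesic_def n_def)
qed

lemma geodesic_adj:
  assumes "geodesic n w" "i \<le> n" "j \<le> n"
  shows "w i \<sim> w j \<longleftrightarrow> j = Suc i \<or> i = Suc j"
proof -
  have "w i \<sim> w j \<longleftrightarrow> dist (w i) (w j) = 1"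
    using assms dist_eq_1 by (auto simp: geodesic_def)
  also have "dist (w i) (w j) = (if i \<le> j then j - i else i - j)"
    using assms dist_sym[of "w i" "w j"] by (auto simp: geodesic_def)
  finally show ?thesis by auto
qed

lemma geodesic_eq:
  assumes "geodesic n w" "i \<le> n" "j \<le> n"
  shows "w i = w j \<longleftrightarrow> i = j"
proof -
  have "dist (w i) (w j) = (if i \<le> j then j - i else i - j)"
    using assms dist_sym[of "w i" "w j"] by (auto simp: geodesic_def)
  then show ?thesis
    using dist_eq_0[of "w i" "w j"] assms by (auto simp: geodesic_def split: if_splits)
qed

end

section \<open>Holes\<close>

context connected_pair_graph
begin

text \<open>
  A hole is an induced cycle of length at least 4, given as a \<open>k\<close>-periodic map on the integers so
  that rotating and reflecting it are changes of variable.
\<close>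

definition hole :: "int \<Rightarrow> (int \<Rightarrow> 'a) \<Rightarrow> bool" where
  "hole k c \<longleftrightarrow> 4 \<le> k \<and> (\<forall>i. c i \<in> pverts G) \<and> (\<forall>i j. c i = c j \<longleftrightarrow> k dvd i - j) \<and>
    (\<forall>i j. c i \<sim> c j \<longleftrightarrow> k dvd i - j - 1 \<or> k dvd i - j + 1)"

section \<open>Symmetries of holes and index arithmetic\<close>

lemma hole_rotate: "hole k c \<Longrightarrow> hole k (\<lambda>i. c (s + i))"
  by (simp add: hole_def)

lemma hole_reflect: "hole k c \<Longrightarrow> hole k (\<lambda>i. c (- i))"
proof -
  have "k dvd - i + j \<longleftrightarrow> k dvd i - j" for i j
    using dvd_minus_iff[of k "i - j"] by simp
  moreover have "k dvd - i + j - 1 \<longleftrightarrow> k dvd i - j + 1" for i j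
    using dvd_minus_iff[of k "i - j + 1"] by (simp add: algebra_simps)
  moreover have "k dvd - i + j + 1 \<longleftrightarrow> k dvd i - j - 1" for i j
    using dvd_minus_iff[of k "i - j - 1"] by (simp add: algebra_simps)
  ultimately show "hole k c \<Longrightarrow> hole k (\<lambda>i. c (- i))"
    by (auto simp: hole_def)
qed

lemma dvd_small_iff: 
  fixes k x :: int
  assumes "- k < x" "x < 2 * k"
  shows "k dvd x \<longleftrightarrow> x = 0 \<or> x = k"
proof
  assume "k dvd x"
  then obtain q where q: "x = k * q" by blast
  have "0 < k" using assms by simp
  have "\<not> q \<le> - 1"
    using mult_left_mono[of q "- 1" k] \<open>0 < k\<close> q assms by auto
  moreover have "\<not> 2 \<le> q"
    using mult_left_mono[of 2 q k] \<open>0 < k\<close> q assms by linarith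
  ultimately have "q = 0 \<or> q = 1" by auto
  then show "x = 0 \<or> x = k" using q by auto
qed auto

lemma hole_adj:
  assumes "hole k c" "0 \<le> i" "i < k" "0 \<le> j" "j < k"
  shows "c i \<sim> c j \<longleftrightarrow> j = i + 1 \<or> i = j + 1 \<or> (i = 0 \<and> j = k - 1) \<or> (j = 0 \<and> i = k - 1)"
proof -
  have "k dvd i - j - 1 \<longleftrightarrow> i = j + 1 \<or> (i = 0 \<and> j = k - 1)"
    using dvd_small_iff[of k "i - j - 1 + k"] assms by auto
  moreover have "k dvd i - j + 1 \<longleftrightarrow> j = i + 1 \<or> (j = 0 \<and> i = k - 1)"
    using dvd_small_iff[of k "i - j + 1"] assms by auto
  ultimately show ?thesis using assms by (auto simp: hole_def)
qed

lemma hole_eq: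
  assumes "hole k c" "0 \<le> i" "i < k" "0 \<le> j" "j < k"
  shows "c i = c j \<longleftrightarrow> i = j"
proof -
  have "c i = c j \<longleftrightarrow> k dvd i - j" using assms(1) by (simp add: hole_def)
  also have "\<dots> \<longleftrightarrow> i = j" using dvd_small_iff[of k "i - j + k"] assms by simp
  finally show ?thesis .
qed

lemma hole_verts: "hole k c \<Longrightarrow> c i \<in> pverts G"
  by (simp add: hole_def)

lemma hole_mod:
  assumes "hole k c"
  shows "c (i mod k) = c i"
proof -
  have "k dvd i mod k - i" by (simp flip: mod_eq_dvd_iff)
  then show ?thesis using assms by (simp add: hole_def)
qed

text \<open>Reading the list modulo its length gives the periodic map. Pairs with
  \<open>i < j\<close> suffice because adjacency is symmetric and irreflexive.\<close>

lemma hole_of_list: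
  assumes "distinct xs" "4 \<le> length xs" "set xs \<subseteq> pverts G"
    and adj: "\<And>i j. i < j \<Longrightarrow> j < length xs \<Longrightarrow>
      xs ! i \<sim> xs ! j \<longleftrightarrow> j = Suc i \<or> (i = 0 \<and> j = length xs - 1)"
  shows "\<exists>c. hole (int (length xs)) c"
proof -
  define k where "k = int (length xs)"
  define c where "c i = xs ! nat (i mod k)" for i
  have k: "4 \<le> k" using assms by (simp add: k_def)
  have lt: "nat (i mod k) < length xs" for i
    using k pos_mod_bound[of k i] pos_mod_sign[of k i] unfolding k_def by linarith
  have "c i = c j \<longleftrightarrow> k dvd i - j" for i j
  proof -
    have "c i = c j \<longleftrightarrow> nat (i mod k) = nat (j mod k)"
      unfolding c_def using assms(1) lt by (simp add: nth_eq_iff_index_eq)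
    also have "\<dots> \<longleftrightarrow> i mod k = j mod k"
      using k by (simp add: eq_nat_nat_iff)
    finally show ?thesis by (simp add: mod_eq_dvd_iff)
  qed
  moreover have "c i \<sim> c j \<longleftrightarrow> k dvd i - j - 1 \<or> k dvd i - j + 1" for i j
  proof -
    define a b where "a = i mod k" and "b = j mod k"
    have ab: "0 \<le> a" "a < k" "0 \<le> b" "b < k"
      using k by (simp_all add: a_def b_def)
    have c_ab: "c i = xs ! nat a" "c j = xs ! nat b"
      by (simp_all add: c_def a_def b_def)
    have lt_adj: "xs ! nat x \<sim> xs ! nat y \<longleftrightarrow> y = x + 1 \<or> (x = 0 \<and> y = k - 1)"
      if "0 \<le> x" "x < y" "y < k" for x y
    proof -
      have "nat x < nat y" "nat y < length xs" using that by (auto simp: k_def)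
      moreover have "nat y = Suc (nat x) \<longleftrightarrow> y = x + 1" using that by linarith
      moreover have "nat y = length xs - 1 \<longleftrightarrow> y = k - 1" "nat x = 0 \<longleftrightarrow> x = 0"
        using that k unfolding k_def by linarith+
      ultimately show ?thesis using adj[of "nat x" "nat y"] by simp
    qed
    have "c i \<sim> c j \<longleftrightarrow> (b = a + 1 \<or> a = b + 1 \<or> (a = 0 \<and> b = k - 1) \<or> (b = 0 \<and> a = k - 1))"
    proof (cases a b rule: linorder_cases)
      case less
      then show ?thesis
        unfolding c_ab using lt_adj[of a b] ab by auto
    next
      case equal
      then show ?thesis unfolding c_ab using k by simp
    next
      case greater
      then show ?thesis
        unfolding c_ab adj_sym[of "xs ! nat a"] using lt_adj[of b a] ab by auto
    qed
    \<comment> \<open>Replacing indices by residues changes their difference by a multiple of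
      \<open>k\<close>.\<close>
    moreover have "k dvd i - j - 1 \<longleftrightarrow> k dvd a - b - 1" "k dvd i - j + 1 \<longleftrightarrow> k dvd a - b + 1"
    proof -
      have "k dvd i - a" "k dvd j - b" unfolding a_def b_def by simp_all
      then have d: "k dvd (i - a) - (j - b)" by (rule dvd_diff)
      show "k dvd i - j - 1 \<longleftrightarrow> k dvd a - b - 1" "k dvd i - j + 1 \<longleftrightarrow> k dvd a - b + 1"
        using dvd_add_right_iff[OF d, of "a - b - 1"] dvd_add_right_iff[OF d, of "a - b + 1"]
        by (simp_all add: algebra_simps)
    qed
    moreover have "k dvd a - b - 1 \<longleftrightarrow> a = b + 1 \<or> (a = 0 \<and> b = k - 1)"
      using dvd_small_iff[of k "a - b - 1 + k"] ab by auto
    moreover have "k dvd a - b + 1 \<longleftrightarrow> b = a + 1 \<or> (b = 0 \<and> a = k - 1)"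
      using dvd_small_iff[of k "a - b + 1"] ab by auto
    ultimately show ?thesis by auto
  qed
  moreover have "c i \<in> pverts G" for i
    using assms(3) lt nth_mem unfolding c_def by blast
  ultimately have "hole k c" using k by (simp add: hole_def)
  then show ?thesis by (auto simp: k_def)
qed

text \<open>List the tails of the arcs of a chordless cycle. An edge between two listed vertices is
  not a chord, so one of its two arcs lies on the cycle.\<close>

lemma not_chordal_imp_hole:
  assumes "\<not> chordal G"
  shows "\<exists>k c. hole k c"
proof -
  obtain p where p: "cycle p" "4 \<le> length p" and no_chord: "\<And>e. \<not> is_chord G p e"
    using assms by (auto simp: chordal_def)
  obtain u where u: "awalk u p u" "distinct (tl (awalk_verts u p))"
    using p(1) by (auto simp: cycle_def)
  define xs where "xs = map fst p"
  define n where "n = length p"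
  have n: "4 \<le> n" "length xs = n" using p by (simp_all add: xs_def n_def)
  have ne: "p \<noteq> []" using p(2) by auto
  \<comment> \<open>The vertex sequence of the closed walk, read once by tails and once by
    heads.\<close>
  have closed: "xs @ [u] = u # map snd p"
  proof -
    have "cas u p u" using u(1) by (simp add: awalk_def)
    then have 1: "awalk_verts u p = fst (hd p) # map snd p" "hd (awalk_verts u p) = u"
        "last (awalk_verts u p) = u"
      using awalk_verts_conv'[of u p u] ne awhd_if_cas[of u p u] awlast_if_cas[of u p u] by simp_all
    moreover have 2: "awalk_verts u p = map fst p @ [snd (last p)]"
      using awalk_verts_conv[of u p] ne by simp
    ultimately have "fst (hd p) = u" "snd (last p) = u" by (metis list.sel(1), metis last_snoc)
    then show ?thesis using 1(1) 2 by (simp add: xs_def)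
  qed
  \<comment> \<open>A cycle is given with distinct heads; the tails form the same multiset.\<close>
  have "distinct (map snd p)"
    using u awalk_verts_conv'[of u p u] ne by (simp add: awalk_def)
  moreover have "mset xs = mset (map snd p)"
    using arg_cong[OF closed, of mset] by simp
  ultimately have "distinct xs"
    by (metis mset_eq_imp_distinct_iff)
  have x0: "xs ! 0 = u"
    using closed n by (metis append_is_Nil_conv hd_append2 hd_conv_nth list.sel(1) list.size(3) not_numeral_le_zero)
  have p_nth: "p ! i = (xs ! i, (xs @ [u]) ! Suc i)" if "i < n" for i
    using that closed by (simp add: xs_def n_def prod_eq_iff)
  have parcs: "set p \<subseteq> parcs G" using u(1) by (simp add: awalk_def)
  have adj: "xs ! i \<sim> xs ! j \<longleftrightarrow> j = Suc i \<or> (i = 0 \<and> j = length xs - 1)"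
    if ij: "i < j" "j < length xs" for i j
  proof
    assume a: "xs ! i \<sim> xs ! j"
    have "(xs ! i, xs ! j) \<in> set p \<or> (xs ! j, xs ! i) \<in> set p"
      using no_chord[of "(xs ! i, xs ! j)"] a ij nth_mem[of i xs] nth_mem[of j xs]
      unfolding is_chord_def xs_def by auto
    then show "j = Suc i \<or> (i = 0 \<and> j = length xs - 1)"
    proof
      assume "(xs ! i, xs ! j) \<in> set p"
      then obtain l where l: "l < n" "p ! l = (xs ! i, xs ! j)"
        unfolding n_def by (metis in_set_conv_nth)
      then have "l = i"
        using p_nth[of l] \<open>distinct xs\<close> ij n by (simp add: nth_eq_iff_index_eq)
      then show ?thesis
        using l p_nth[of l] \<open>distinct xs\<close> ij n by (simp add: nth_append nth_eq_iff_index_eq)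
    next
      assume "(xs ! j, xs ! i) \<in> set p"
      then obtain l where l: "l < n" "p ! l = (xs ! j, xs ! i)"
        unfolding n_def by (metis in_set_conv_nth)
      then have "l = j"
        using p_nth[of l] \<open>distinct xs\<close> ij n by (simp add: nth_eq_iff_index_eq)
      \<comment> \<open>An arc from \<open>xs ! j\<close> back to the earlier \<open>xs ! i\<close>
        can only be the closing arc, which ends at \<open>u\<close>.\<close>
      then have "(xs @ [u]) ! Suc j = xs ! i"
        using l p_nth[of l] by simp
      then have "Suc j = n \<and> xs ! 0 = xs ! i"
        using \<open>distinct xs\<close> ij n x0
        by (auto simp: nth_append nth_eq_iff_index_eq split: if_splits)
      moreover have "0 < length xs" using n by linarith
      ultimately show ?thesis
        using \<open>distinct xs\<close> ij n nth_eq_iff_index_eq[of xs 0 i] by auto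
    qed
  next
    assume "j = Suc i \<or> (i = 0 \<and> j = length xs - 1)"
    then consider "j = Suc i" | "i = 0" "j = n - 1" using n by auto
    then show "xs ! i \<sim> xs ! j"
    proof cases
      case 1
      then have "p ! i = (xs ! i, xs ! j)"
        using p_nth[of i] ij n by (simp add: nth_append)
      then show ?thesis using parcs nth_mem[of i p] ij n n_def by auto
    next
      case 2
      then have "p ! j = (xs ! j, xs ! i)"
        using p_nth[of j] ij n x0 by (simp add: nth_append)
      then show ?thesis using parcs nth_mem[of j p] ij n n_def adj_sym by auto
    qed
  qed
  have "set xs \<subseteq> pverts G"
  proof
    fix x assume "x \<in> set xs"
    then obtain e where "e \<in> set p" "x = fst e" by (auto simp: xs_def)
    then show "x \<in> pverts G" using parcs arc_fst_in_verts by blast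
  qed
  then show ?thesis
    using hole_of_list[OF \<open>distinct xs\<close>] adj n by blast
qed

section \<open>Paths as vertex lists along holes and geodesics\<close>

lemma successively_adj_rev:
  assumes "successively (\<sim>) xs"
  shows "successively (\<sim>) (rev xs)"
proof -
  have "successively (\<lambda>x y. y \<sim> x) xs"
    using assms adj_sym unfolding successively_conv_nth by blast
  then show ?thesis by simp
qed

lemma last_upto: "a \<le> b \<Longrightarrow> last [a..b] = b"
  by (simp add: upto_rec2)

lemma hd_upto: "a \<le> b \<Longrightarrow> hd [a..b] = a"
  by (simp add: upto_rec1)

lemma successively_map_hole: "hole k c \<Longrightarrow> successively (\<sim>) (map c [a..b])"
  unfolding successively_conv_nth by (auto simp: hole_def)

lemma successively_map_geodesic:
  "geodesic n w \<Longrightarrow> b \<le> Suc n \<Longrightarrow> successively (\<sim>) (map w [a..<b])"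
  unfolding successively_conv_nth by (auto simp: geodesic_adj)

end

section \<open>A shortest hole is isometric\<close>

text \<open>
  The ends of an induced path on 4 vertices are at distance 2 or 3, so the second assumption makes it
  a geodesic.
\<close>

locale shortest_hole = connected_pair_graph +
  fixes k :: int
  assumes shortest: "hole k' c' \<Longrightarrow> k \<le> k'"
    and induced_P4: "a \<sim> b \<Longrightarrow> b \<sim> c \<Longrightarrow> c \<sim> d \<Longrightarrow> \<not> a \<sim> c \<Longrightarrow> \<not> b \<sim> d \<Longrightarrow> dist a d \<noteq> 2"
begin

text \<open>In a cycle shorter than every hole, the edge joining the last vertex to the first lies
  in a triangle on the cycle. Cutting along chords keeps this edge; a cycle without chords has
  length 3, being too short for a hole.\<close>

lemma short_cycle_triangle:
  assumes "distinct xs" "successively (\<sim>) xs" "3 \<le> length xs" "int (length xs) < k"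
    and "hd xs \<sim> last xs"
  shows "\<exists>z\<in>set xs. z \<sim> hd xs \<and> z \<sim> last xs"
  using assms
proof (induction "length xs" arbitrary: xs rule: less_induct)
  case less
  define n where "n = length xs"
  have n: "3 \<le> n" "int n < k" using less.prems by (simp_all add: n_def)
  have step: "xs ! i \<sim> xs ! Suc i" if "Suc i < n" for i
    using less.prems(2) that unfolding successively_conv_nth n_def by simp
  have hd_last: "hd xs = xs ! 0" "last xs = xs ! (n - 1)"
    using n hd_conv_nth[of xs] last_conv_nth[of xs] by (cases "xs = []"; simp add: n_def)+
  show ?case
  proof (cases "\<exists>i j. Suc i < j \<and> j < n \<and> (i, j) \<noteq> (0, n - 1) \<and> xs ! i \<sim> xs ! j")
    case True
    then obtain i j where ij: "Suc i < j" "j < n" "(i, j) \<noteq> (0, n - 1)" "xs ! i \<sim> xs ! j" by blast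
    \<comment> \<open>The chord replaces the stretch strictly between \<open>i\<close> and
      \<open>j\<close>. Both ends survive, and excluding the pair \<open>(0, n - 1)\<close> leaves
      at least three vertices.\<close>
    define ys where "ys = take (Suc i) xs @ drop j xs"
    have len: "length ys = Suc i + (n - j)" using ij by (simp add: ys_def n_def)
    have "set ys \<subseteq> set xs"
      unfolding ys_def by (auto dest: in_set_takeD in_set_dropD)
    have hd: "hd ys = hd xs" using ij by (cases xs) (auto simp: ys_def n_def)
    have last: "last ys = last xs" using ij by (auto simp: ys_def n_def)
    have "distinct ys"
      unfolding ys_def using less.prems(1) ij
      by (simp add: set_take_disj_set_drop_if_distinct)
    moreover have "successively (\<sim>) ys"
    proof -
      have "successively (\<sim>) (take (Suc i) xs)" "successively (\<sim>) (drop j xs)"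
        using less.prems(2) by (auto simp: successively_conv_nth)
      moreover have "last (take (Suc i) xs) \<sim> hd (drop j xs)"
        using ij by (simp add: n_def take_Suc_conv_app_nth hd_drop_conv_nth)
      ultimately show ?thesis
        unfolding ys_def successively_append_iff by blast
    qed
    ultimately have "\<exists>z\<in>set ys. z \<sim> hd ys \<and> z \<sim> last ys"
      using less.prems(5) ij n len hd last by (intro less.hyps) (auto simp: n_def)
    then show ?thesis
      using \<open>set ys \<subseteq> set xs\<close> hd last by auto
  next
    case False
    have adj: "xs ! i \<sim> xs ! j \<longleftrightarrow> j = Suc i \<or> (i = 0 \<and> j = length xs - 1)"
      if "i < j" "j < length xs" for i j
      using False that step[of i] less.prems(5) hd_last unfolding n_def
      by (metis Suc_lessI prod.inject)
    have "set xs \<subseteq> pverts G"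
    proof
      fix x assume "x \<in> set xs"
      then obtain i where "i < n" "x = xs ! i" unfolding n_def by (metis in_set_conv_nth)
      then show "x \<in> pverts G"
        using step[of i] step[of "i - 1"] n wellformed' by (cases "Suc i < n") auto
    qed
    then have "n < 4"
      using hole_of_list[OF less.prems(1)] adj shortest n by (force simp: n_def)
    then have "n = 3" using n by simp
    then show ?thesis
      using step[of 0] step[of 1] adj_sym hd_last n_def
      by (intro bexI[of _ "xs ! 1"]) (auto simp: numeral_2_eq_2)
  qed
qed

text \<open>Apply \<open>short_cycle_triangle\<close> to the cycle \<open>c 0, ..., c j, w\<close>
  of length \<open>j + 2\<close>. Its edge between \<open>w\<close> and \<open>c 0\<close> lies in a
  triangle, and on this arc the only neighbour of \<open>c 0\<close> is \<open>c 1\<close>.\<close>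

lemma hole_nbr_1:
  assumes c: "hole k c" and w: "\<And>i. w \<noteq> c i" and adj: "w \<sim> c 0" "w \<sim> c j"
    and j: "2 \<le> j" "j + 2 < k"
  shows "w \<sim> c 1"
proof -
  define xs where "xs = map c [0..j] @ [w]"
  have hd: "hd xs = c 0" using j by (simp add: xs_def upto_rec1)
  have last: "last xs = w" by (simp add: xs_def)
  have "inj_on c {0..j}"
    using hole_eq[OF c] j by (auto intro!: inj_onI)
  then have "distinct xs"
    using w by (auto simp: xs_def distinct_map)
  moreover have "successively (\<sim>) xs"
    unfolding xs_def successively_append_iff using successively_map_hole[OF c] adj adj_sym j
    by (auto simp: last_map last_upto)
  ultimately have "\<exists>z\<in>set xs. z \<sim> hd xs \<and> z \<sim> last xs"
    using j adj adj_sym hd last by (intro short_cycle_triangle) (auto simp: xs_def)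
  then obtain z where z: "z \<in> set xs" "z \<sim> c 0" "z \<sim> w"
    using hd last by auto
  then obtain i where "0 \<le> i" "i \<le> j" "z = c i" by (auto simp: xs_def)
  then have "z = c 1"
    using z(2) hole_adj[OF c, of i 0] j by auto
  then show ?thesis using z(3) adj_sym by simp
qed

lemma hole_dist_3: "hole k c \<Longrightarrow> 6 \<le> k \<Longrightarrow> dist (c 0) (c 3) \<noteq> 2"
  by (rule induced_P4[of "c 0" "c 1" "c 2" "c 3"]) (simp_all add: hole_adj)

text \<open>Applying \<open>hole_nbr_1\<close> along the arc makes \<open>w\<close> adjacent to
  \<open>c 1\<close>, \<open>c 2\<close> and \<open>c 3\<close>; then \<open>c 0\<close> and
  \<open>c 3\<close> are at distance 2 through \<open>w\<close>, the forbidden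
  configuration.\<close>

lemma hole_nbrs_close:
  assumes c: "hole k c" and w: "\<And>i. w \<noteq> c i" and adj: "w \<sim> c 0" "w \<sim> c j"
  shows "\<not> (3 \<le> j \<and> j \<le> k - 3)"
proof
  assume j: "3 \<le> j \<and> j \<le> k - 3"
  have "w \<sim> c 1"
    using hole_nbr_1[OF c w adj] j by simp
  moreover from this have "w \<sim> c 2"
    using hole_nbr_1[OF hole_rotate[OF c, of 1], of w "j - 1"] w adj j by simp
  moreover from this have "w \<sim> c 3"
    using hole_nbr_1[OF hole_rotate[OF c, of 2], of w "j - 2"] w adj j by (cases "j = 3") auto
  ultimately have "dist (c 0) (c 3) = 2"
    using dist_eq_2[of "c 0" w "c 3"] adj adj_sym hole_adj[OF c, of 0 3] hole_eq[OF c, of 0 3] j by auto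
  with hole_dist_3[OF c] j show False by simp
qed

text \<open>The arc from \<open>c 0\<close> to \<open>c j\<close> and the geodesic form a cycle of
  length \<open>j + n\<close>. Consider the triangle on its edge between \<open>c 0\<close> and
  \<open>w 1\<close>.\<close>

lemma shortcut_nbr_1:
  assumes c: "hole k c" and g: "geodesic n w" and ends: "w 0 = c 0" "w n = c j"
    and off: "\<And>i l. 0 < i \<Longrightarrow> i < n \<Longrightarrow> w i \<noteq> c l"
    and n: "2 \<le> n" "int n < j" "j + int n < k"
  shows "w 1 \<sim> c 1"
proof -
  define xs where "xs = map c [0..j] @ map w (rev [1..<n])"
  have hd: "hd xs = c 0" using n by (simp add: xs_def upto_rec1)
  have last: "last xs = w 1" using n by (simp add: xs_def last_map last_rev upt_conv_Cons)
  have "inj_on c {0..j}"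
    using hole_eq[OF c] n by (auto intro!: inj_onI)
  moreover have "inj_on w {1..<n}"
    using geodesic_eq[OF g] by (auto intro!: inj_onI)
  moreover have "c ` {0..j} \<inter> w ` {1..<n} = {}"
  proof -
    have "c l \<notin> w ` {1..<n}" for l
    proof
      assume "c l \<in> w ` {1..<n}"
      then obtain i where "i \<in> {1..<n}" "c l = w i" ..
      then show False using off[of i l] by simp
    qed
    then show ?thesis by blast
  qed
  ultimately have "distinct xs"
    by (simp add: xs_def distinct_map)
  moreover have "successively (\<sim>) xs"
  proof -
    have "successively (\<sim>) (map w (rev [1..<n]))"
      using successively_adj_rev[OF successively_map_geodesic[OF g, of n 1]] by (simp add: rev_map)
    moreover have "c j \<sim> w (n - 1)"
      using geodesic_adj[OF g, of n "n - 1"] ends n by simp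
    ultimately show ?thesis
      unfolding xs_def successively_append_iff using successively_map_hole[OF c] n
      by (auto simp: last_map last_upto hd_map hd_rev)
  qed
  moreover have "w 1 \<sim> c 0"
    using geodesic_adj[OF g, of 1 0] ends n by simp
  ultimately have "\<exists>z\<in>set xs. z \<sim> hd xs \<and> z \<sim> last xs"
    using n adj_sym hd last by (intro short_cycle_triangle) (auto simp: xs_def)
  then obtain z where z: "z \<in> set xs" "z \<sim> c 0" "z \<sim> w 1"
    using hd last by auto
  then consider i where "0 \<le> i" "i \<le> j" "z = c i" | i where "1 \<le> i" "i < n" "z = w i"
    by (auto simp: xs_def)
  then show ?thesis
  proof cases
    case 1
    then have "z = c 1"
      using z(2) hole_adj[OF c, of i 0] n by auto
    then show ?thesis using z(3) adj_sym by simp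
  next
    case 2
    \<comment> \<open>A vacuous case: \<open>z\<close> would be adjacent to itself.\<close>
    then have "z = w 1"
      using z(2) geodesic_adj[OF g, of i 0] ends by auto
    then show ?thesis using z(3) by simp
  qed
qed

text \<open>Replace \<open>c 0\<close> by a direct step from \<open>w 1\<close> to
  \<open>c 1\<close>. The new cycle has length \<open>j + n - 1\<close>, and the triangle is taken
  on its edge between \<open>w 1\<close> and \<open>w 2\<close>.\<close>

lemma shortcut_nbr_2:
  assumes c: "hole k c" and g: "geodesic n w" and ends: "w 0 = c 0" "w n = c j"
    and off: "\<And>i l. 0 < i \<Longrightarrow> i < n \<Longrightarrow> w i \<noteq> c l"
    and n: "3 \<le> n" "int n < j" "j + int n < k"
    and w1: "w 1 \<sim> c 1" "w 1 \<sim> c (- 1)"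
  shows "w 2 \<sim> c 1"
proof -
  define xs where "xs = w 1 # map c [1..j] @ map w (rev [2..<n])"
  have hd: "hd xs = w 1" by (simp add: xs_def)
  have last: "last xs = w 2" using n by (simp add: xs_def last_map last_rev upt_conv_Cons)
  have "inj_on c {1..j}"
    using hole_eq[OF c] n by (auto intro!: inj_onI)
  moreover have "inj_on w {2..<n}"
    using geodesic_eq[OF g] by (auto intro!: inj_onI)
  moreover have "c ` {1..j} \<inter> w ` {2..<n} = {}" "w 1 \<notin> c ` {1..j}"
  proof -
    have "c l \<notin> w ` {1..<n}" for l
    proof
      assume "c l \<in> w ` {1..<n}"
      then obtain i where "i \<in> {1..<n}" "c l = w i" ..
      then show False using off[of i l] by simp
    qed
    moreover have "{2..<n} \<subseteq> {1..<n}" "w 1 \<in> w ` {1..<n}" using n by auto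
    ultimately show "c ` {1..j} \<inter> w ` {2..<n} = {}" "w 1 \<notin> c ` {1..j}"
      by (blast, metis imageE)
  qed
  moreover have "w 1 \<notin> w ` {2..<n}"
  proof
    assume "w 1 \<in> w ` {2..<n}"
    then obtain i where "i \<in> {2..<n}" "w 1 = w i" ..
    then show False using geodesic_eq[OF g, of 1 i] by simp
  qed
  ultimately have "distinct xs"
    by (simp add: xs_def distinct_map)
  moreover have "successively (\<sim>) xs"
  proof -
    have "successively (\<sim>) (map w (rev [2..<n]))"
      using successively_adj_rev[OF successively_map_geodesic[OF g, of n 2]] by (simp add: rev_map)
    moreover have "c j \<sim> w (n - 1)"
      using geodesic_adj[OF g, of n "n - 1"] ends n by simp
    moreover have "[1..j] \<noteq> []" "hd [1..j] = 1" "last [1..j] = j"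
      using n by (simp_all add: hd_upto last_upto)
    ultimately show ?thesis
      unfolding xs_def successively_append_iff successively_Cons using successively_map_hole[OF c] n w1
      by (auto simp: last_map hd_map hd_rev)
  qed
  moreover have "w 1 \<sim> w 2"
    using geodesic_adj[OF g, of 1 2] n by simp
  ultimately have "\<exists>z\<in>set xs. z \<sim> hd xs \<and> z \<sim> last xs"
    using n hd last by (intro short_cycle_triangle) (auto simp: xs_def)
  then obtain z where z: "z \<in> set xs" "z \<sim> w 1" "z \<sim> w 2"
    using hd last by auto
  then consider i where "1 \<le> i" "i \<le> j" "z = c i" | i where "2 \<le> i" "i < n" "z = w i"
    by (auto simp: xs_def)
  then show ?thesis
  proof cases
    case 1
    have off1: "w 1 \<noteq> c l" for l using off[of 1] n by simp
    have "w 1 \<sim> c 0" using geodesic_adj[OF g, of 1 0] ends n by simp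
    moreover have "w 1 \<sim> c i" using z(2) 1 adj_sym by simp
    ultimately have "i \<le> 2"
      using hole_nbrs_close[OF c off1] 1 n by fastforce
    \<comment> \<open>\<open>c 2\<close> lies three steps after \<open>c (- 1)\<close>, which is
      already a neighbour of \<open>w 1\<close>.\<close>
    moreover have "i \<noteq> 2"
      using hole_nbrs_close[OF hole_rotate[OF c, of "-1"], of "w 1" 3] off1 w1 n \<open>w 1 \<sim> c i\<close> by auto
    ultimately have "i = 1" using 1 by linarith
    then have "z = c 1" using 1 by simp
    then show ?thesis using z(3) adj_sym by simp
  next
    case 2
    then have "i = 2"
      using z(2) geodesic_adj[OF g, of i 1] by simp
    then have "z = w 2" using 2 by simp
    then show ?thesis using z(3) by simp
  qed
qed

text \<open>Induction on the distance, for all rotations at once. A shortcut meeting the hole in its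
  interior splits into two shorter ones; otherwise the local lemmas apply on both sides of
  \<open>c 0\<close>.\<close>

lemma hole_dist_ge:
  assumes "hole k c" "0 \<le> j" "j \<le> k"
  shows "min j (k - j) \<le> int (dist (c 0) (c j))"
  using assms
proof (induction "dist (c 0) (c j)" arbitrary: c j rule: less_induct)
  case less
  note c = less.prems(1)
  define n where "n = dist (c 0) (c j)"
  show ?case
  proof (rule ccontr)
    assume "\<not> ?thesis"
    then have n: "int n < j" "j + int n < k" by (simp_all add: n_def)
    obtain w where g: "geodesic n w" and ends: "w 0 = c 0" "w n = c j"
      using geodesic_exists[OF hole_verts[OF c] hole_verts[OF c]] unfolding n_def by blast
    have "n \<noteq> 0"
      using dist_eq_0[of "c 0" "c j"] hole_verts[OF c] hole_eq[OF c, of 0 j] n by (auto simp: n_def)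
    moreover have "n \<noteq> 1"
      using dist_eq_1[of "c 0" "c j"] hole_verts[OF c] hole_adj[OF c, of 0 j] n by (auto simp: n_def)
    ultimately have n2: "2 \<le> n" by simp
    have off: "w i \<noteq> c l" if i: "0 < i" "i < n" for i l
    proof
      assume "w i = c l"
      define m where "m = l mod k"
      have m: "0 \<le> m" "m < k" "w i = c m"
        using n \<open>w i = c l\<close> hole_mod[OF c] by (simp_all add: m_def)
      \<comment> \<open>The number of steps along the hole from \<open>c m\<close> forward to
        \<open>c j\<close>, wrapping around if necessary.\<close>
      define j' where "j' = (if m \<le> j then j - m else j - m + k)"
      have cj': "c (m + j') = c j"
        using c by (auto simp: j'_def hole_def)
      have d: "dist (c 0) (c m) = i" "dist (c m) (c j) = n - i"
        using g i ends m(3) by (metis geodesic_def diff_zero le0 less_imp_le_nat order_refl)+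
      have "min m (k - m) \<le> int i"
        using less.hyps[of c m] d m i c by (simp add: n_def)
      moreover have "min j' (k - j') \<le> int (n - i)"
        using less.hyps[of "\<lambda>i. c (m + i)" j'] d m i hole_rotate[OF c] cj' n 
        by (simp add: n_def j'_def)
      ultimately show False
        using m n i by (auto simp: j'_def split: if_splits)
    qed
    have off1: "w 1 \<noteq> c l" for l using off[of 1] n2 by simp
    have w10: "w 1 \<sim> c 0" using geodesic_adj[OF g, of 1 0] ends n2 by simp
    show False
    proof (cases "n = 2")
      case True
      then have "w 1 \<sim> c j" using geodesic_adj[OF g, of 1 2] ends by simp
      moreover have "3 \<le> j \<and> j \<le> k - 3" using n True by simp
      ultimately show False
        using hole_nbrs_close[OF c off1 w10] by blast
    next
      case False
      then have n3: "3 \<le> n" using n2 by simp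
      \<comment> \<open>Reflection turns the other arc, of length \<open>k - j\<close>, into the one
        treated by the shortcut lemmas.\<close>
      note c' = hole_reflect[OF c]
      have ends': "w 0 = c (- 0)" "w n = c (- (k - j))"
        using ends c by (auto simp: hole_def)
      have off': "w i \<noteq> c (- l)" if "0 < i" "i < n" for i l using off that by simp
      have n': "int n < k - j" "k - j + int n < k" using n by simp_all
      have w1: "w 1 \<sim> c 1"
        by (rule shortcut_nbr_1[OF c g ends off n2 n])
      have w1': "w 1 \<sim> c (- 1)"
        by (rule shortcut_nbr_1[OF c' g ends' off' n2 n'])
      have w2: "w 2 \<sim> c 1"
        by (rule shortcut_nbr_2[OF c g ends off n3 n w1 w1'])
      have w2': "w 2 \<sim> c (- 1)"
        using shortcut_nbr_2[OF c' g ends' off' n3 n'] w1 w1' by simp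
      \<comment> \<open>Seen from \<open>c (- 1)\<close>, the vertex \<open>c 1\<close> has index 2
        and \<open>c 0\<close> has index 1. But \<open>w 2\<close> is at distance 2 from
        \<open>w 0 = c 0\<close>.\<close>
      have "w 2 \<sim> c 0"
        using hole_nbr_1[OF hole_rotate[OF c, of "-1"], of "w 2" 2] off[of 2] n3 n w2 w2' by simp
      then show False
        using geodesic_adj[OF g, of 2 0] ends n3 by simp
    qed
  qed
qed

text \<open>The upper bounds come from walking along the two arcs.\<close>

lemma hole_dist:
  assumes c: "hole k c" and j: "0 \<le> j" "j \<le> k"
  shows "int (dist (c i) (c (i + j))) = min j (k - j)"
proof -
  have le: "int (dist (c i) (c (i + j))) \<le> j" if "0 \<le> j" for i j
  proof -
    have "dist (c i) (c (i + j)) \<le> nat j"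
    proof (rule graph_dist_le)
      show "(c i, c (i + j)) \<in> parcs G ^^ nat j"
        unfolding relpow_fun_conv using that c
        by (intro exI[of _ "\<lambda>l. c (i + int l)"]) (auto simp: hole_def)
    qed (rule hole_verts[OF c])
    then show ?thesis using that by simp
  qed
  have "c (i + j + (k - j)) = c i"
    using c by (simp add: hole_def)
  then have "int (dist (c i) (c (i + j))) \<le> k - j"
    using le[of "k - j" "i + j"] j dist_sym[of "c i"] by simp
  moreover have "min j (k - j) \<le> int (dist (c i) (c (i + j)))"
    using hole_dist_ge[OF hole_rotate[OF c, of i] j] by simp
  ultimately show ?thesis using le[OF j(1), of i] by simp
qed

end

section \<open>Test vectors\<close>

locale enumerated_graph = connected_pair_graph +
  fixes vs :: "'a list"
  assumes distinct_vs: "distinct vs" and set_vs: "set vs = pverts G"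
    and two_verts: "2 \<le> card (pverts G)"
begin

text \<open>Extension by zero of a vector indexed by chosen vertices, written as a sum so that
  exchanging sums evaluates inner products.\<close>

definition extend :: "nat \<Rightarrow> (nat \<Rightarrow> 'a) \<Rightarrow> (nat \<Rightarrow> real) \<Rightarrow> 'a \<Rightarrow> real" where
  "extend m us x v = (\<Sum>a<m. if v = us a then x a else 0)"

lemma sum_vs: "(\<Sum>i = 0..<length vs. h (vs ! i)) = (\<Sum>v\<in>pverts G. h v)"
  using sum.reindex_bij_betw[OF bij_betw_nth[OF distinct_vs refl refl], of h] set_vs
  by (simp add: lessThan_atLeast0)

lemma sum_extend:
  assumes "us ` {..<m} \<subseteq> pverts G"
  shows "(\<Sum>v\<in>pverts G. extend m us x v * h v) = (\<Sum>a<m. x a * h (us a))"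
proof -
  have "(\<Sum>v\<in>pverts G. extend m us x v * h v)
      = (\<Sum>v\<in>pverts G. \<Sum>a<m. if v = us a then x a * h v else 0)"
    unfolding extend_def sum_distrib_right by (intro sum.cong) auto
  also have "\<dots> = (\<Sum>a<m. \<Sum>v\<in>pverts G. if v = us a then x a * h v else 0)"
    by (rule sum.swap)
  also have "\<dots> = (\<Sum>a<m. x a * h (us a))"
    using assms pair_finite_verts by (intro sum.cong) auto
  finally show ?thesis .
qed

lemma extend_eq:
  assumes "inj_on us {..<m}" "a < m"
  shows "extend m us x (us a) = x a"
proof -
  have "extend m us x (us a) = (\<Sum>b<m. if a = b then x b else 0)"
    unfolding extend_def using assms by (intro sum.cong) (auto dest: inj_onD)
  then show ?thesis using assms by simp
qed

text \<open>After extension by zero, the hypotheses of \<open>second_eigenvalue_ge\<close> involve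
  only the distance table of the \<open>m\<close> chosen vertices, so they become finite
  computations.\<close>

lemma distance_lambda2_ge:
  fixes x y :: "nat \<Rightarrow> real"
  assumes inj: "inj_on us {..<m}" and us: "us ` {..<m} \<subseteq> pverts G"
    and x0: "a < m" "x a \<noteq> 0" and y0: "b < m" "y b \<noteq> 0"
    and xy: "(\<Sum>a<m. x a * y a) = 0"
    and Dxy: "(\<Sum>a<m. x a * (\<Sum>b<m. y b * dist (us a) (us b))) = 0"
    and Dxx: "c * (\<Sum>a<m. x a * x a) \<le> (\<Sum>a<m. x a * (\<Sum>b<m. x b * dist (us a) (us b)))"
    and Dyy: "c * (\<Sum>a<m. y a * y a) \<le> (\<Sum>a<m. y a * (\<Sum>b<m. y b * dist (us a) (us b)))"
  shows "c \<le> distance_lambda2 G vs"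
proof -
  let ?D = "distance_matrix G vs" and ?n = "length vs"
  define lift where "lift x = vec ?n (\<lambda>i. extend m us x (vs ! i))" for x
  have D: "?D \<in> carrier_mat ?n ?n" by (simp add: distance_matrix_def)
  have sym: "transpose_mat ?D = ?D"
    by (rule eq_matI) (auto simp: distance_matrix_def dist_sym)
  have n: "2 \<le> ?n"
    using two_verts distinct_card[OF distinct_vs] set_vs by simp
  have carrier: "lift x \<in> carrier_vec ?n" for x by (simp add: lift_def)
  have inner: "lift x \<bullet> lift y = (\<Sum>a<m. x a * y a)" for x y
  proof -
    have "lift x \<bullet> lift y = (\<Sum>v\<in>pverts G. extend m us x v * extend m us y v)"
      using sum_vs[of "\<lambda>v. extend m us x v * extend m us y v"]
      by (simp add: lift_def scalar_prod_def)
    then show ?thesis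
      using sum_extend[OF us] extend_eq[OF inj] by simp
  qed
  have form: "lift x \<bullet> (?D *\<^sub>v lift y) = (\<Sum>a<m. x a * (\<Sum>b<m. y b * dist (us a) (us b)))" for x y
  proof -
    have Dy: "(?D *\<^sub>v lift y) $ i = (\<Sum>b<m. y b * dist (vs ! i) (us b))" if "i < ?n" for i
    proof -
      have "(?D *\<^sub>v lift y) $ i = (\<Sum>v\<in>pverts G. extend m us y v * dist (vs ! i) v)"
        using that sum_vs[of "\<lambda>v. extend m us y v * dist (vs ! i) v"]
        by (simp add: lift_def scalar_prod_def distance_matrix_def mult.commute)
      then show ?thesis using sum_extend[OF us] by simp
    qed
    have "lift x \<bullet> (?D *\<^sub>v lift y)
        = (\<Sum>v\<in>pverts G. extend m us x v * (\<Sum>b<m. y b * dist v (us b)))"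
      using Dy sum_vs[of "\<lambda>v. extend m us x v * (\<Sum>b<m. y b * dist v (us b))"] D
      by (simp add: scalar_prod_def[of "lift x"] carrier_matD) (simp add: lift_def)
    then show ?thesis using sum_extend[OF us] by simp
  qed
  have ne: "lift x \<noteq> 0\<^sub>v ?n" if "a < m" "x a \<noteq> 0" for x a
  proof
    assume "lift x = 0\<^sub>v ?n"
    then have "(\<Sum>a<m. x a * x a) = 0"
      using inner[of x x] carrier[of x] by simp
    then have "x a * x a = 0"
      using that by (subst (asm) sum_nonneg_eq_0_iff) auto
    with that show False by simp
  qed
  show ?thesis
    unfolding distance_lambda2_def
    using second_eigenvalue_ge[OF D sym n carrier ne[where x = x, OF x0] carrier ne[where x = y, OF y0], of c]
      xy Dxy Dxx Dyy by (simp add: inner form)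
qed

text \<open>
  With \<open>\<phi>\<close> the golden ratio, \<open>(1, -\<phi>, \<phi>, -1)\<close> is an eigenvector of the distance
  matrix of the four vertices, with eigenvalue \<open>\<phi> - 2 = (-3 + sqrt 5) / 2\<close>.
\<close>

lemma distance_lambda2_ge_P4:
  assumes adj: "a \<sim> b" "b \<sim> c" "c \<sim> d" "\<not> a \<sim> c" "\<not> b \<sim> d" and "dist a d = 2"
  shows "(- 3 + sqrt 5) / 2 \<le> distance_lambda2 G vs"
proof -
  define \<phi> where "\<phi> = (1 + sqrt 5) / 2"
  have \<phi>: "\<phi> * \<phi> = \<phi> + 1" "(- 3 + sqrt 5) / 2 = \<phi> - 2"
    by (simp_all add: \<phi>_def field_simps)
  have "sqrt 5 \<le> 3" by (rule real_le_lsqrt) auto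
  then have \<phi>_le: "\<phi> \<le> 2" by (simp add: \<phi>_def)
  have V: "a \<in> pverts G" "b \<in> pverts G" "c \<in> pverts G" "d \<in> pverts G"
    using adj wellformed' by blast+
  have "\<not> a \<sim> d" "a \<noteq> d"
    using dist_eq_1[of a d] dist_eq_0[of a d] V \<open>dist a d = 2\<close> by auto
  then have ne: "a \<noteq> b" "a \<noteq> c" "a \<noteq> d" "b \<noteq> c" "b \<noteq> d" "c \<noteq> d"
    using adj not_adj_self by metis+
  have dist: "dist a b = 1" "dist b c = 1" "dist c d = 1" "dist a c = 2" "dist b d = 2" "dist a d = 2"
    using dist_eq_1 dist_eq_2 V adj ne \<open>dist a d = 2\<close> by simp_all
  then have dist': "dist b a = 1" "dist c b = 1" "dist d c = 1" "dist c a = 2" "dist d b = 2" "dist d a = 2"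
    using dist_sym by metis+
  have "\<phi> - 2 \<le> distance_lambda2 G vs"
  \<comment> \<open>Reversing the path preserves its distances, negates \<open>x\<close> and fixes
    the constant vector \<open>y\<close>, so both orthogonality sums cancel. The form of
    \<open>y\<close> is nonnegative, while \<phi> - 2 \<le> 0.\<close>
  proof (rule distance_lambda2_ge[where m = 4 and us = "(!) [a, b, c, d]"
        and x = "(!) [1, - \<phi>, \<phi>, - 1]" and y = "\<lambda>_. 1" and a = 0 and b = 0])
    show "inj_on ((!) [a, b, c, d]) {..<4}"
      using ne by (intro inj_on_nth) auto
    show "(!) [a, b, c, d] ` {..<4} \<subseteq> pverts G"
      using V by (auto simp: less_Suc_eq numeral_eq_Suc)
  qed (use dist dist' V \<phi> \<phi>_le in \<open>simp_all add: numeral_eq_Suc algebra_simps\<close>)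
  then show ?thesis using \<phi>(2) by simp
qed

end

locale enumerated_shortest_hole = enumerated_graph + shortest_hole
begin

lemma real_hole_dist:
  assumes "hole k c" "i \<le> j" "j - i \<le> k"
  shows "real (dist (c i) (c j)) = real_of_int (min (j - i) (k - (j - i)))"
  using hole_dist[OF assms(1), of "j - i" i] assms(2,3)
  by (metis add.commute diff_add_cancel diff_ge_0_iff_ge of_int_of_nat_eq)

text \<open>On two opposite edges of the cycle the vector (1, -1, 1, -1) is annihilated by the
  distance table, so its form is 0. The constant vector serves as the second one.\<close>

lemma distance_lambda2_ge_even:
  assumes c: "hole k c" and k: "k = 2 * m"
  shows "(- 3 + sqrt 5) / 2 \<le> distance_lambda2 G vs"
proof -
  define \<gamma> where "\<gamma> = (- 3 + sqrt 5) / 2"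
  have "sqrt 5 \<le> 3" by (rule real_le_lsqrt) auto
  then have \<gamma>: "\<gamma> \<le> 0" by (simp add: \<gamma>_def)
  have m: "2 \<le> m" using c k by (simp add: hole_def)
  have d: "real (dist (c 0) (c 1)) = 1" "real (dist (c 0) (c m)) = m" "real (dist (c 0) (c (m + 1))) = m - 1"
    "real (dist (c 1) (c m)) = m - 1" "real (dist (c 1) (c (m + 1))) = m" "real (dist (c m) (c (m + 1))) = 1"
    using m by (simp_all add: real_hole_dist[OF c] k min_def)
  then have d': "real (dist (c 1) (c 0)) = 1" "real (dist (c m) (c 0)) = m" "real (dist (c (m + 1)) (c 0)) = m - 1"
    "real (dist (c m) (c 1)) = m - 1" "real (dist (c (m + 1)) (c 1)) = m" "real (dist (c (m + 1)) (c m)) = 1"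
    using dist_sym by metis+
  have "\<gamma> \<le> distance_lambda2 G vs"
  proof (rule distance_lambda2_ge[where m = 4 and us = "(!) [c 0, c 1, c m, c (m + 1)]"
        and x = "(!) [1, - 1, 1, - 1]" and y = "\<lambda>_. 1" and a = 0 and b = 0])
    show "inj_on ((!) [c 0, c 1, c m, c (m + 1)]) {..<4}"
      using m k hole_eq[OF c] by (intro inj_on_nth) auto
    show "(!) [c 0, c 1, c m, c (m + 1)] ` {..<4} \<subseteq> pverts G"
      using hole_verts[OF c] by (auto simp: less_Suc_eq numeral_eq_Suc)
  qed (use m \<gamma> hole_verts[OF c] in \<open>simp_all add: numeral_eq_Suc d d'\<close>)
  then show ?thesis by (simp add: \<gamma>_def)
qed

text \<open>
  On an odd cycle of length \<open>2 m + 1\<close> the negated distance form of a vector with zero sum is the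
  sum of the squares of its sums over the arcs of \<open>m\<close> consecutive vertices.  The test vector
  \<open>(1, 1, 2, -2, -1, -1)\<close> is chosen so that four of these sums are \<open>\<plusminus>1\<close> and the others vanish.
\<close>

lemma distance_lambda2_ge_odd:
  assumes c: "hole k c" and k: "k = 2 * m + 1" and m: "3 \<le> m"
  shows "(- 3 + sqrt 5) / 2 \<le> distance_lambda2 G vs"
proof -
  define \<gamma> where "\<gamma> = (- 3 + sqrt 5) / 2"
  \<comment> \<open>The test vector has form -4 and squared norm 12, so the bound -1/3 is what the
    form requires.\<close>
  have "sqrt 5 \<le> 7 / 3" by (rule real_le_lsqrt) (auto simp: power2_eq_square)
  then have \<gamma>: "\<gamma> \<le> - 1 / 3" by (simp add: \<gamma>_def)
  define us where "us = [c 0, c 1, c (m + 1), c 2, c (m + 2), c (m + 3)]"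
  have d:
    "real (dist (c 0) (c 1)) = 1" "real (dist (c 0) (c 2)) = 2" "real (dist (c 1) (c 2)) = 1"
    "real (dist (c 0) (c (m + 1))) = m" "real (dist (c 0) (c (m + 2))) = m - 1"
    "real (dist (c 0) (c (m + 3))) = m - 2"
    "real (dist (c 1) (c (m + 1))) = m" "real (dist (c 1) (c (m + 2))) = m"
    "real (dist (c 1) (c (m + 3))) = m - 1"
    "real (dist (c 2) (c (m + 1))) = m - 1" "real (dist (c 2) (c (m + 2))) = m"
    "real (dist (c 2) (c (m + 3))) = m"
    "real (dist (c (m + 1)) (c (m + 2))) = 1" "real (dist (c (m + 1)) (c (m + 3))) = 2"
    "real (dist (c (m + 2)) (c (m + 3))) = 1"
    using m by (simp_all add: real_hole_dist[OF c] k min_def)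
  then have d':
    "real (dist (c 1) (c 0)) = 1" "real (dist (c 2) (c 0)) = 2" "real (dist (c 2) (c 1)) = 1"
    "real (dist (c (m + 1)) (c 0)) = m" "real (dist (c (m + 2)) (c 0)) = m - 1"
    "real (dist (c (m + 3)) (c 0)) = m - 2"
    "real (dist (c (m + 1)) (c 1)) = m" "real (dist (c (m + 2)) (c 1)) = m"
    "real (dist (c (m + 3)) (c 1)) = m - 1"
    "real (dist (c (m + 1)) (c 2)) = m - 1" "real (dist (c (m + 2)) (c 2)) = m"
    "real (dist (c (m + 3)) (c 2)) = m"
    "real (dist (c (m + 2)) (c (m + 1))) = 1" "real (dist (c (m + 3)) (c (m + 1))) = 2"
    "real (dist (c (m + 3)) (c (m + 2))) = 1"
    using dist_sym by metis+
  have "\<gamma> \<le> distance_lambda2 G vs"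
  \<comment> \<open>The reflection taking index \<open>i\<close> to \<open>m + 3 - i\<close> negates
    \<open>x\<close> and fixes the constant \<open>y\<close>, which gives orthogonality. For
    \<open>m = 2\<close> the vertices \<open>c 0\<close> and \<open>c (m + 3)\<close> would
    coincide.\<close>
  proof (rule distance_lambda2_ge[where m = 6 and us = "(!) us"
        and x = "(!) [1, 1, 2, - 2, - 1, - 1]" and y = "\<lambda>_. 1" and a = 0 and b = 0])
    show "inj_on ((!) us) {..<6}"
      using m k hole_eq[OF c] unfolding us_def by (intro inj_on_nth) auto
    show "(!) us ` {..<6} \<subseteq> pverts G"
      using hole_verts[OF c] by (auto simp: us_def less_Suc_eq numeral_eq_Suc)
  qed (use m \<gamma> hole_verts[OF c] in \<open>simp_all add: us_def numeral_eq_Suc d d'\<close>)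
  then show ?thesis by (simp add: \<gamma>_def)
qed

end

section \<open>Contradiction at a shortest hole\<close>

theorem theorem3p2:
  fixes G :: "'a pair_pre_digraph" and vs :: "'a list"
  assumes "pair_graph G"
    and "Digraph_Component.connected (with_proj G)"
    and "2 \<le> card (pverts G)"
    and "distinct vs" and "set vs = pverts G"
    and "distance_lambda2 G vs < (- 3 + sqrt 5) / 2"
  shows "chordal G"
proof (rule ccontr)
  interpret pair_graph G by fact
  interpret enumerated_graph G vs
    by unfold_locales (use assms in auto)
  assume "\<not> chordal G"
  then obtain k0 c0 where "hole k0 c0" using not_chordal_imp_hole by blast
  \<comment> \<open>Hole lengths are integers; passing to naturals makes \<open>LEAST\<close>
    available for choosing a shortest hole.\<close>
  then have "\<exists>n c. hole (int n) c"
    by (intro exI[of _ "nat k0"] exI[of _ c0]) (simp add: hole_def)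
  from LeastI_ex[OF this] obtain c where c: "hole (int (LEAST n. \<exists>c. hole (int n) c)) c" ..
  define k where "k = int (LEAST n. \<exists>c. hole (int n) c)"
  interpret enumerated_shortest_hole G vs k
  proof unfold_locales
    fix k' c' assume h: "hole k' c'"
    then have "4 \<le> k'" by (simp add: hole_def)
    with h have "hole (int (nat k')) c'" by simp
    then have "(LEAST n. \<exists>c. hole (int n) c) \<le> nat k'" by (blast intro: Least_le)
    with \<open>4 \<le> k'\<close> show "k \<le> k'" by (simp add: k_def)
  next
    fix u v w x assume "u \<sim> v" "v \<sim> w" "w \<sim> x" "\<not> u \<sim> w" "\<not> v \<sim> x"
    then show "dist u x \<noteq> 2"
      using distance_lambda2_ge_P4[of u v w x] assms(6) by auto
  qed
  have c: "hole k c" using c by (simp add: k_def)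
  then have "4 \<le> k" by (simp add: hole_def)
  \<comment> \<open>Even lengths and odd lengths from 7 on are excluded by test vectors, which
    leaves 5.\<close>
  have "\<not> (\<exists>m. k = 2 * m)" "\<not> (\<exists>m. k = 2 * m + 1 \<and> 3 \<le> m)"
    using distance_lambda2_ge_even[OF c] distance_lambda2_ge_odd[OF c] assms(6) by force+
  then have "k = 5"
    using \<open>4 \<le> k\<close> by presburger
  then have "dist (c 0) (c 3) = 2"
    using hole_dist[OF c, of 3 0] by simp
  \<comment> \<open>On a 5-cycle \<open>c 0, c 1, c 2, c 3\<close> is an induced path whose ends are
    joined by two steps through the fifth vertex.\<close>
  moreover have "dist (c 0) (c 3) \<noteq> 2"
    using \<open>k = 5\<close> by (intro induced_P4[of "c 0" "c 1" "c 2" "c 3"]) (simp_all add: hole_adj[OF c])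
  ultimately show False by simp
qed

end
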